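(* Let $N,m,k\ge1$ be integers, let $p,q,n,s>0$ with $\min\{p+q,n+s\}>2$, and let $K,L$ be potentials satisfying the assumptions listed in the context. Consider the system $$(S)\qquad\begin{cases}\dfrac{\partial^ku}{\partial t^k}+(-\Delta)^mu\ \ge\ (K\ast|v|^p)|v|^q & \text{in }\mathbb R^{N+1}_+=\mathbb R^N\times(0,\infty),\\[2mm] \dfrac{\partial^kv}{\partial t^k}+(-\Delta)^mv\ \ge\ (L\ast|u|^n)|u|^s & \text{in }\mathbb R^{N+1}_+,\\[2mm] \dfrac{\partial^iu}{\partial t^i}(x,0)=u_i(x),\quad \dfrac{\partial^iv}{\partial t^i}(x,0)=v_i(x) & \text{in }\mathbb R^N,\ 0\le i\le k-1.\end{cases}$$ If either $$\limsup_{R\to\infty}K(R)\,L(R)^{\frac1{n+s}}\,R^{\frac{2N+2m/k}{(n+s)(p+q)}+\frac{N+2m}{n+s}-N+2m\left(1-\frac1k\right)}>0,$$ or $$\limsup_{R\to\infty}K(R)^{\frac1{p+q}}\,L(R)\,R^{\frac{2N+2m/k}{(n+s)(p+q)}+\frac{N+2m}{p+q}-N+2m\left(1-\frac1k\right)}>0,$$ then $(S)$ has no nontrivial weak solutions $(u,v)$ (that is, every such weak solution is $(u,v)=(0,0)$ a.e.) whose initial data satisfy $$\text{either}\quad u_{k-1},v_{k-1}\ge0,\qquad\text{or}\qquad u_{k-1},v_{k-1}\in L^1(\mathbb R^N)\ \text{ and }\ \int_{\mathbb R^N}u_{k-1}(x)\,dx>0,\ \int_{\mathbb R^N}v_{k-1}(x)\,dx>0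 .$$
   Context: Write $\mathbb R_+=(0,\infty)$ and $\mathbb R^{N+1}_+=\mathbb R^N\times\mathbb R_+$. Assumptions on the potentials: $K,L\in C(\mathbb R_+;\mathbb R_+)$ (continuous and positive), $x\mapsto K(|x|)$ and $x\mapsto L(|x|)$ belong to $L^1_{\rm loc}(\mathbb R^N)$, and there exists $R_0>1$ such that $\inf_{r\in(0,R)}K(r)=K(R)$ and $\inf_{r\in(0,R)}L(r)=L(R)$ for all $R>R_0$. Convolution: $(K\ast|v|^p)(x,t)=\int_{\mathbb R^N}K(|x-y|)|v(y,t)|^p\,dy$, and similarly for $L\ast|u|^n$; these are required to be finite for almost all $(x,t)\in\mathbb R^{N+1}_+$. Weak solution: given $u_i,v_i\in L^1_{\rm loc}(\mathbb R^N)$, $0\le i\le k-1$, a weak solution of $(S)$ is a pair $(u,v)\in L^n_{\rm loc}\times L^p_{\rm loc}$ such that $(L\ast|u|^n)|u|^s,\ (K\ast|v|^p)|v|^q\in L^1_{\rm loc}$ (local integrability being understood on $\mathbb R^N\times[0,\infty)$) and, for every nonnegative $\varphi\in C_c^\infty(\mathbb R^N\times\mathbb R)$, $$\sum_{i=1}^k(-1)^i\int_{\mathbb R^N}u_{k-i}(x)\frac{\partial^{i-1}\varphi}{\partial t^{i-1}}(x,0)\,dx+\int_{\mathbb R^{N+1}_+}u\Big[(-1)^k\frac{\partial^k\varphi}{\partial t^k}+(-\Delta)^m\varphi\Big]dx\,dt\ \ge\ \int_{\mathbb R^{N+1}_+}(K\ast|v|^p)|v|^q\varphi\,dx\,dt,$$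 $$\sum_{i=1}^k(-1)^i\int_{\mathbb R^N}v_{k-i}(x)\frac{\partial^{i-1}\varphi}{\partial t^{i-1}}(x,0)\,dx+\int_{\mathbb R^{N+1}_+}v\Big[(-1)^k\frac{\partial^k\varphi}{\partial t^k}+(-\Delta)^m\varphi\Big]dx\,dt\ \ge\ \int_{\mathbb R^{N+1}_+}(L\ast|u|^n)|u|^s\varphi\,dx\,dt,$$ with the integrals in these inequalities well defined. *)

theory Defs
  imports "HOL-Analysis.Analysis"
begin

text \<open>The space \<open>\<real>\<^sup>N\<close> is a type \<open>'a::euclidean_space\<close> with \<open>N = DIM('a)\<close> (so \<open>N \<ge> 1\<close>),
  and space-time is the Euclidean space \<open>'a \<times> real\<close>.\<close>

definition upper_half :: "('a::euclidean_space \<times> real) set" where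
  "upper_half = UNIV \<times> {0<..}"

text \<open>\<open>Lloc r \<Omega>\<close>: functions in \<open>L\<^sup>r\<close> of every bounded piece of \<open>\<Omega>\<close>, local integrability being
  understood up to the boundary of \<open>\<Omega>\<close>. Any real \<open>r > 0\<close> is allowed; as \<open>\<bar>w\<bar>\<^sup>r\<close> loses the sign
  of \<open>w\<close>, measurability of \<open>w\<close> is a separate requirement. The values of \<open>w\<close> outside \<open>\<Omega>\<close> are
  irrelevant.\<close>

definition Lloc :: "real \<Rightarrow> 'b::euclidean_space set \<Rightarrow> ('b \<Rightarrow> real) set" where
  "Lloc r \<Omega> = {w. set_borel_measurable lebesgue \<Omega> w \<and>
     (\<forall>C. compact C \<and> C \<subseteq> closure \<Omega> \<longrightarrow> set_integrable lebesgue (C \<inter> \<Omega>) (\<lambda>z. \<bar>w z\<bar> powr r))}"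

lemma closure_upper_half: "closure upper_half = UNIV \<times> {0..}"
  by (simp add: upper_half_def closure_Times)

definition partial :: "'b::euclidean_space \<Rightarrow> ('b \<Rightarrow> real) \<Rightarrow> 'b \<Rightarrow> real" where
  "partial b f z = frechet_derivative f (at z) b"

primrec Ck :: "nat \<Rightarrow> ('b::euclidean_space \<Rightarrow> real) \<Rightarrow> bool" where
  "Ck 0 f \<longleftrightarrow> continuous_on UNIV f"
| "Ck (Suc j) f \<longleftrightarrow> f differentiable_on UNIV \<and> (\<forall>b\<in>Basis. Ck j (partial b f))"

definition Cc_infinity :: "('b::euclidean_space \<Rightarrow> real) set" where
  "Cc_infinity = {f. (\<forall>j. Ck j f) \<and> compact (closure {z. f z \<noteq> 0})}"

definition dt :: "('a::euclidean_space \<times> real \<Rightarrow> real) \<Rightarrow> 'a \<times> real \<Rightarrow> real" where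
  "dt = partial (0, 1)"

definition laplace_x :: "('a::euclidean_space \<times> real \<Rightarrow> real) \<Rightarrow> 'a \<times> real \<Rightarrow> real" where
  "laplace_x f z = (\<Sum>b\<in>Basis. partial (b, 0) (partial (b, 0) f) z)"

definition polyharmonic :: "nat \<Rightarrow> ('a::euclidean_space \<times> real \<Rightarrow> real) \<Rightarrow> 'a \<times> real \<Rightarrow> real" where
  "polyharmonic m f = ((\<lambda>g z. - laplace_x g z) ^^ m) f"

text \<open>\<open>(K \<star> |w|\<^sup>r)(x,t)\<close>. The integrand is nonnegative for \<open>y \<noteq> x\<close>, so that finiteness of the
  integral is integrability. The value \<open>K 0\<close> only matters on the null set \<open>{x}\<close>.\<close>

definition conv_integrand ::
    "(real \<Rightarrow> real) \<Rightarrow> real \<Rightarrow> ('a::euclidean_space \<times> real \<Rightarrow> real) \<Rightarrow> 'a \<times> real \<Rightarrow> 'a \<Rightarrow> real" where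
  "conv_integrand K r w z y = K (norm (fst z - y)) * \<bar>w (y, snd z)\<bar> powr r"

definition conv_finite ::
    "(real \<Rightarrow> real) \<Rightarrow> real \<Rightarrow> ('a::euclidean_space \<times> real \<Rightarrow> real) \<Rightarrow> bool" where
  "conv_finite K r w \<longleftrightarrow>
     (AE z in lebesgue. z \<in> upper_half \<longrightarrow> integrable lebesgue (conv_integrand K r w z))"

definition conv ::
    "(real \<Rightarrow> real) \<Rightarrow> real \<Rightarrow> ('a::euclidean_space \<times> real \<Rightarrow> real) \<Rightarrow> 'a \<times> real \<Rightarrow> real" where
  "conv K r w z = (LINT y|lebesgue. conv_integrand K r w z y)"

text \<open>Weak form of \<open>\<partial>\<^sub>t\<^sup>k w + (-\<Delta>)\<^sup>m w \<ge> F\<close> with \<open>\<partial>\<^sub>t\<^sup>i w(\<cdot>,0) = w0 i\<close> for \<open>i < k\<close>. The integrability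
  conditions say that all the integrals in the inequality are well defined.\<close>

definition weak_inequality ::
    "nat \<Rightarrow> nat \<Rightarrow> (nat \<Rightarrow> 'a::euclidean_space \<Rightarrow> real) \<Rightarrow>
     ('a \<times> real \<Rightarrow> real) \<Rightarrow> ('a \<times> real \<Rightarrow> real) \<Rightarrow> bool" where
  "weak_inequality k m w0 w F \<longleftrightarrow>
     (\<forall>\<phi>\<in>Cc_infinity. (\<forall>z. 0 \<le> \<phi> z) \<longrightarrow>
        (\<forall>i\<in>{1..k}. integrable lebesgue (\<lambda>x. w0 (k - i) x * (dt ^^ (i - 1)) \<phi> (x, 0))) \<and>
        set_integrable lebesgue upper_half
          (\<lambda>z. w z * ((-1) ^ k * (dt ^^ k) \<phi> z + polyharmonic m \<phi> z)) \<and>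
        set_integrable lebesgue upper_half (\<lambda>z. F z * \<phi> z) \<and>
        (\<Sum>i=1..k. (-1) ^ i * (LINT x|lebesgue. w0 (k - i) x * (dt ^^ (i - 1)) \<phi> (x, 0)))
          + (LINT z:upper_half|lebesgue. w z * ((-1) ^ k * (dt ^^ k) \<phi> z + polyharmonic m \<phi> z))
        \<ge> (LINT z:upper_half|lebesgue. F z * \<phi> z))"

definition weak_solution ::
    "nat \<Rightarrow> nat \<Rightarrow> (real \<Rightarrow> real) \<Rightarrow> (real \<Rightarrow> real) \<Rightarrow> real \<Rightarrow> real \<Rightarrow> real \<Rightarrow> real \<Rightarrow>
     (nat \<Rightarrow> 'a::euclidean_space \<Rightarrow> real) \<Rightarrow> (nat \<Rightarrow> 'a \<Rightarrow> real) \<Rightarrow>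
     ('a \<times> real \<Rightarrow> real) \<Rightarrow> ('a \<times> real \<Rightarrow> real) \<Rightarrow> bool" where
  "weak_solution k m K L p q n s u0 v0 u v \<longleftrightarrow>
     (\<forall>i<k. u0 i \<in> Lloc 1 UNIV \<and> v0 i \<in> Lloc 1 UNIV) \<and>
     u \<in> Lloc n upper_half \<and> v \<in> Lloc p upper_half \<and>
     conv_finite K p v \<and> conv_finite L n u \<and>
     (\<lambda>z. conv L n u z * \<bar>u z\<bar> powr s) \<in> Lloc 1 upper_half \<and>
     (\<lambda>z. conv K p v z * \<bar>v z\<bar> powr q) \<in> Lloc 1 upper_half \<and>
     weak_inequality k m u0 u (\<lambda>z. conv K p v z * \<bar>v z\<bar> powr q) \<and>
     weak_inequality k m v0 v (\<lambda>z. conv L n u z * \<bar>u z\<bar> powr s)"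

end

theory Submission
  imports Defs "HOL-Computational_Algebra.Polynomial"
begin

text \<open>Test the two inequalities with \<open>\<phi>\<^sub>R(x,t) = \<phi>(x/R, t/T)\<close>, \<open>T = R\<^bsup>2m/k\<^esup>\<close>, where \<open>\<phi>\<close> is a high
  power of a cutoff. Since \<open>K (\<bar>x - y\<bar>) \<ge> K (4R)\<close> on the support, the Cauchy-Schwarz inequality
  bounds the right-hand side of the first inequality from below by \<open>K (4R) P\<close>, where
  \<open>P = \<integral> (\<integral> \<bar>v\<bar>\<^bsup>(p+q)/2\<^esup> \<phi>\<^sub>R dx)\<^sup>2 dt\<close>. The left-hand side only sees the region where \<open>\<phi>\<^sub>R\<close> is not
  locally constant, and Hoelder's inequality bounds it by a power of \<open>R\<close> times \<open>J'\<^bsup>1/(n+s)\<^esup>\<close>, where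
  \<open>J'\<close> is the analogous quantity for \<open>u\<close> restricted to that region. The same bound with exchanged
  roles estimates \<open>J'\<close> by the corresponding \<open>P'\<close>, so that
  \<open>K (4R) L (4R)\<^bsup>1/(n+s)\<^esup> P \<le> C R\<^sup>E P'\<^bsup>1/((n+s)(p+q))\<^esup>\<close>. Along a sequence realising the upper limit this
  first bounds \<open>P\<close>; hence \<open>P'\<close>, an integral over a region escaping to infinity, tends to \<open>0\<close>, and
  therefore so does \<open>P\<close>. Thus \<open>v = 0\<close>, and then \<open>u = 0\<close>.\<close>

subsection \<open>Smooth functions\<close>

text \<open>The convolution acts in x only, whereas testing integrates over t as well. The merged
  estimate therefore holds time by time, and the natural quantity is the square of a slice integral,
  integrated in t. Neither energy is assumed finite: testing with a compactly supported function
  bounds the energy of v by a finite integral, and that of u likewise, so each inequality supplies a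
  premise of the other. The hypotheses p + q > 2 and n + s > 2 act twice: (p + q)/2 and (n + s)/2
  become Hoelder exponents above 1, and the final power 1/((n + s)(p + q)) is below 1, so that the
  energy can be absorbed. The initial data enter only through \<open>u0 (k - 1)\<close> and
  \<open>v0 (k - 1)\<close>, because the test function is independent of t near t = 0; the sign in
  front of the remaining term allows it to be dropped. The exponent E collects -2m from the rescaled
  operators, the volume of a ball of radius 2R and the time length R^(2m/k); it is the negative of
  the exponent in the upper limit condition.\<close>

lemma partial_eqI: "(f has_derivative f') (at z) \<Longrightarrow> partial b f z = f' b"
  unfolding partial_def by (metis frechet_derivative_at)

lemma partial_const: "partial b (\<lambda>z. c) z = 0"
  using partial_eqI[OF has_derivative_const] by auto

lemma has_derivative_partial:
  assumes "f differentiable (at z)"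
  shows "\<exists>f'. (f has_derivative f') (at z) \<and> (\<forall>b. partial b f z = f' b)"
  using assms partial_eqI by (metis differentiable_def)

lemma Ck_continuous: "Ck j f \<Longrightarrow> continuous_on UNIV f"
  by (cases j) (auto intro: differentiable_imp_continuous_on)

lemma Ck_Suc_imp: "Ck (Suc j) f \<Longrightarrow> Ck j f"
proof (induction j arbitrary: f)
  case 0
  then show ?case by (simp add: differentiable_imp_continuous_on)
next
  case (Suc j)
  then show ?case by (metis Ck.simps(2))
qed

lemma Ck_const: "Ck j (\<lambda>z. c)"
proof (induction j arbitrary: c)
  case (Suc j)
  have "partial b (\<lambda>z::'a. c) = (\<lambda>z. 0)" for b
    by (auto intro!: ext partial_eqI[of _ "\<lambda>_. 0", simplified])
  then show ?case using Suc by simp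
qed simp

lemma Ck_linear:
  assumes "bounded_linear f"
  shows "Ck j f"
proof (cases j)
  case 0
  then show ?thesis using assms by (simp add: linear_continuous_on)
next
  case (Suc i)
  have d: "(f has_derivative f) (at z)" for z
    by (rule bounded_linear_imp_has_derivative[OF assms])
  then have "partial b f = (\<lambda>z. f b)" for b
    using partial_eqI by blast
  then show ?thesis using d Suc
    by (auto simp: Ck_const differentiable_on_def differentiable_def intro: has_derivative_at_withinI)
qed

lemma Ck_add:
  assumes "Ck j f" "Ck j g"
  shows "Ck j (\<lambda>z. f z + g z)"
  using assms
proof (induction j arbitrary: f g)
  case 0
  then show ?case by (auto intro: continuous_intros)
next
  case (Suc j)
  have d: "f differentiable (at z)" "g differentiable (at z)" for z
    using Suc.prems by (auto simp: differentiable_on_def)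
  have "partial b (\<lambda>z. f z + g z) = (\<lambda>z. partial b f z + partial b g z)" for b
  proof
    fix z
    obtain f' g' where "(f has_derivative f') (at z)" "partial b f z = f' b"
      "(g has_derivative g') (at z)" "partial b g z = g' b"
      using has_derivative_partial d by metis
    then show "partial b (\<lambda>z. f z + g z) z = partial b f z + partial b g z"
      using partial_eqI[OF has_derivative_add] by fastforce
  qed
  then show ?case using Suc by (auto intro: derivative_intros)
qed

lemma partial_mult:
  assumes "f differentiable (at z)" "g differentiable (at z)"
  shows "partial b (\<lambda>z. f z * g z) z = f z * partial b g z + partial b f z * g z"
proof -
  obtain f' g' where "(f has_derivative f') (at z)" "partial b f z = f' b"
    "(g has_derivative g') (at z)" "partial b g z = g' b"
    using has_derivative_partial assms by metis
  then show ?thesis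
    using partial_eqI[OF has_derivative_mult] by fastforce
qed

lemma Ck_mult:
  assumes "Ck j f" "Ck j g"
  shows "Ck j (\<lambda>z. f z * g z)"
  using assms
proof (induction j arbitrary: f g)
  case 0
  then show ?case by (auto intro: continuous_intros)
next
  case (Suc j)
  have d: "f differentiable (at z)" "g differentiable (at z)" for z
    using Suc.prems by (auto simp: differentiable_on_def)
  have "partial b (\<lambda>z. f z * g z) = (\<lambda>z. f z * partial b g z + partial b f z * g z)" for b
    using partial_mult d by blast
  then show ?case using Suc Ck_Suc_imp[OF Suc.prems(1)] Ck_Suc_imp[OF Suc.prems(2)]
    by (auto intro!: derivative_intros Ck_add)
qed

text \<open>The outer function comes as a whole sequence of successive derivatives: the chain rule
  turns \<open>D i\<close> into \<open>D (Suc i)\<close>, so the induction has to range over all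
  \<open>i\<close>.\<close>

lemma Ck_compose:
  assumes D: "\<And>i x. (D i has_real_derivative D (Suc i) x) (at x)"
    and "Ck j g"
  shows "Ck j (\<lambda>z. D i (g z))"
  using assms(2)
proof (induction j arbitrary: i)
  case 0
  have "continuous_on UNIV (D i)"
    using D by (meson DERIV_isCont continuous_at_imp_continuous_on)
  then show ?case using 0 by (auto intro: continuous_on_compose2)
next
  case (Suc j)
  have g: "g differentiable (at z)" for z
    using Suc.prems by (auto simp: differentiable_on_def)
  have d: "\<exists>h. ((\<lambda>z. D i (g z)) has_derivative h) (at z)
      \<and> (\<forall>b. h b = D (Suc i) (g z) * partial b g z)" for z
  proof -
    obtain g' where g': "(g has_derivative g') (at z)" "\<And>b. partial b g z = g' b"
      using has_derivative_partial g by metis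
    have "((\<lambda>z. D i (g z)) has_derivative (\<lambda>b. g' b * D (Suc i) (g z))) (at z)"
      by (rule DERIV_compose_FDERIV[OF D g'(1)])
    then show ?thesis using g' by (auto simp: mult.commute)
  qed
  have "partial b (\<lambda>z. D i (g z)) = (\<lambda>z. D (Suc i) (g z) * partial b g z)" for b
    using d partial_eqI by (metis (lifting) ext)
  moreover have "(\<lambda>z. D i (g z)) differentiable_on UNIV"
    unfolding differentiable_on_def differentiable_def using d
    by (meson has_derivative_at_withinI)
  ultimately show ?case
    using Suc.IH[OF Ck_Suc_imp[OF Suc.prems], of "Suc i"] Suc.prems by (auto intro: Ck_mult)
qed

definition smooth :: "('b::euclidean_space \<Rightarrow> real) \<Rightarrow> bool" where
  "smooth f \<longleftrightarrow> (\<forall>j. Ck j f)"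

lemma smooth_differentiable: "smooth f \<Longrightarrow> f differentiable (at z)"
  unfolding smooth_def by (metis Ck.simps(2) UNIV_I differentiable_on_def)

lemma smooth_partial: "smooth f \<Longrightarrow> b \<in> Basis \<Longrightarrow> smooth (partial b f)"
  unfolding smooth_def by (metis Ck.simps(2))

lemma smooth_continuous: "smooth f \<Longrightarrow> continuous_on UNIV f"
  unfolding smooth_def using Ck_continuous by blast

lemma smooth_const: "smooth (\<lambda>z. c)"
  and smooth_linear: "bounded_linear f \<Longrightarrow> smooth f"
  and smooth_add: "smooth f \<Longrightarrow> smooth g \<Longrightarrow> smooth (\<lambda>z. f z + g z)"
  and smooth_mult: "smooth f \<Longrightarrow> smooth g \<Longrightarrow> smooth (\<lambda>z. f z * g z)"
  unfolding smooth_def by (auto intro: Ck_const Ck_linear Ck_add Ck_mult)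

lemma smooth_cmult: "smooth f \<Longrightarrow> smooth (\<lambda>z. c * f z)"
  by (intro smooth_mult smooth_const)

lemma smooth_power: "smooth f \<Longrightarrow> smooth (\<lambda>z. f z ^ i)"
  by (induction i) (auto intro: smooth_mult smooth_const)

lemma smooth_sum: "(\<And>i. i \<in> I \<Longrightarrow> smooth (f i)) \<Longrightarrow> smooth (\<lambda>z. \<Sum>i\<in>I. f i z)"
  by (induction I rule: infinite_finite_induct) (auto intro: smooth_add smooth_const)

section \<open>A flat function and the cutoff built from it\<close>

definition exp_recip :: "real poly \<Rightarrow> real \<Rightarrow> real" where
  "exp_recip P x = (if x > 0 then poly P (1 / x) * exp (- (1 / x)) else 0)"

lemma poly_mult_exp_tendsto_0: "((\<lambda>y::real. poly P y * exp (- y)) \<longlongrightarrow> 0) at_top"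
proof -
  have "((\<lambda>y::real. \<Sum>i\<le>degree P. coeff P i * (y ^ i / exp y)) \<longlongrightarrow> (\<Sum>i\<le>degree P. coeff P i * 0)) at_top"
    by (intro tendsto_intros tendsto_power_div_exp_0)
  then show ?thesis
    by (simp add: poly_altdef sum_distrib_right exp_minus divide_inverse mult.assoc)
qed

text \<open>The polynomial parameter makes the class closed under differentiation: for x > 0 the
  derivative of P(1/x) exp(-1/x) is (1/x)^2 (P - P')(1/x) exp(-1/x). Iterating this map on
  polynomials yields all higher derivatives at once.\<close>

lemma exp_recip_has_derivative:
  "(exp_recip P has_real_derivative exp_recip ([:0, 0, 1:] * (P - pderiv P)) x) (at x)"
proof (cases x "0::real" rule: linorder_cases)
  case greater
  have "((\<lambda>x. poly P (1 / x) * exp (- (1 / x))) has_real_derivative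
      exp_recip ([:0, 0, 1:] * (P - pderiv P)) x) (at x)"
    using greater unfolding exp_recip_def
    by (auto intro!: derivative_eq_intros DERIV_chain'[OF _ poly_DERIV] simp: field_simps power2_eq_square)
  then show ?thesis
    by (rule has_field_derivative_transform_within_open[where S = "{0<..}"]) (use greater in \<open>auto simp: exp_recip_def\<close>)
next
  case less
  have "((\<lambda>x. 0) has_real_derivative exp_recip ([:0, 0, 1:] * (P - pderiv P)) x) (at x)"
    using less by (simp add: exp_recip_def)
  then show ?thesis
    by (rule has_field_derivative_transform_within_open[where S = "{..<0}"]) (use less in \<open>auto simp: exp_recip_def\<close>)
next
  case equal
  \<comment> \<open>The right difference quotient at 0 is again of the form Q(1/y) exp(-1/y), with
    \<open>[:0, 1:] * P\<close> absorbing the division by y.\<close>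
  have "((\<lambda>y. poly ([:0, 1:] * P) (1 / y) * exp (- (1 / y))) \<longlongrightarrow> 0) (at_right 0)"
    using filterlim_compose[OF poly_mult_exp_tendsto_0[of "[:0, 1:] * P"] filterlim_inverse_at_top_right]
    by (simp add: inverse_eq_divide)
  then have r: "((\<lambda>y. exp_recip P y / y) \<longlongrightarrow> 0) (at_right 0)"
    by (rule Lim_transform_eventually)
      (auto simp: exp_recip_def eventually_at_filter)
  have l: "((\<lambda>y. exp_recip P y / y) \<longlongrightarrow> 0) (at_left 0)"
    by (rule tendsto_eventually) (auto simp: exp_recip_def eventually_at_filter)
  show ?thesis
    using r l filterlim_split_at_real equal unfolding has_field_derivative_iff
    by (auto simp: exp_recip_def)
qed

lemma smooth_exp_recip:
  assumes "smooth g"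
  shows "smooth (\<lambda>z. exp_recip P (g z))"
proof -
  define D where "D i = exp_recip (((\<lambda>P. [:0, 0, 1:] * (P - pderiv P)) ^^ i) P)" for i
  have "(D i has_real_derivative D (Suc i) x) (at x)" for i x
    unfolding D_def using exp_recip_has_derivative by simp
  from Ck_compose[of D, OF this] show ?thesis
    using assms unfolding smooth_def D_def by (metis funpow_0)
qed

text \<open>With \<open>e x = exp (- 1 / x)\<close> for \<open>x > 0\<close> and \<open>e x = 0\<close> otherwise, the composition
  \<open>e (e 3 - e (r - 1))\<close> is constant for \<open>r \<le> 1\<close> and vanishes for \<open>r \<ge> 4\<close>.\<close>

definition cutoff :: "real \<Rightarrow> real" where
  "cutoff r = exp_recip 1 (exp_recip 1 3 - exp_recip 1 (r - 1)) / exp_recip 1 (exp_recip 1 3)"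

lemma exp_recip_1_mono: "x \<le> y \<Longrightarrow> exp_recip 1 x \<le> exp_recip 1 y"
  by (auto simp: exp_recip_def field_simps)

lemma exp_recip_1_pos: "x > 0 \<Longrightarrow> exp_recip 1 x > 0"
  by (auto simp: exp_recip_def)

lemma exp_recip_1_nonneg: "exp_recip 1 x \<ge> 0"
  by (auto simp: exp_recip_def)

lemma cutoff_nonneg: "0 \<le> cutoff r"
  and cutoff_le_1: "cutoff r \<le> 1"
  and cutoff_eq_1: "r \<le> 1 \<Longrightarrow> cutoff r = 1"
  and cutoff_eq_0: "4 \<le> r \<Longrightarrow> cutoff r = 0"
proof -
  have p: "exp_recip 1 (exp_recip 1 3) > 0"
    by (simp add: exp_recip_1_pos)
  show "0 \<le> cutoff r"
    by (simp add: cutoff_def exp_recip_1_nonneg)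
  show "cutoff r \<le> 1"
    using p exp_recip_1_nonneg unfolding cutoff_def by (simp add: exp_recip_1_mono)
  show "cutoff r = 1" if "r \<le> 1"
    using that p unfolding cutoff_def by (simp add: exp_recip_def)
  show "cutoff r = 0" if "4 \<le> r"
    using exp_recip_1_mono[of 3 "r - 1"] that by (simp add: cutoff_def exp_recip_def[of 1 "_ - _"])
qed

lemma smooth_cutoff:
  assumes "smooth g"
  shows "smooth (\<lambda>z. cutoff (g z))"
proof -
  have "smooth (\<lambda>z. 1 / exp_recip 1 (exp_recip 1 3) *
      exp_recip 1 (exp_recip 1 3 + (-1) * exp_recip 1 (g z + (-1))))"
    by (intro smooth_cmult smooth_exp_recip smooth_add smooth_const assms)
  then show ?thesis unfolding cutoff_def by simp
qed

subsection \<open>Derivatives of powers, vanishing and scaling\<close>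

text \<open>The factor \<open>f z ^ i\<close> left over after differentiating a high power of \<open>f\<close> is what makes
  \<open>\<bar>D (f ^ (i + l))\<bar> \<le> C (f ^ (i + l)) powr \<theta>\<close> for an operator \<open>D\<close> of order \<open>l\<close>.\<close>

definition power_mult :: "('b::euclidean_space \<Rightarrow> real) \<Rightarrow> nat \<Rightarrow> ('b \<Rightarrow> real) set" where
  "power_mult f i = {w. \<exists>g. smooth g \<and> w = (\<lambda>z. f z ^ i * g z)}"

lemma power_mult_add:
  assumes "v \<in> power_mult f i" "w \<in> power_mult f i"
  shows "(\<lambda>z. v z + w z) \<in> power_mult f i"
proof -
  obtain g h where gh: "smooth g" "v = (\<lambda>z. f z ^ i * g z)" "smooth h" "w = (\<lambda>z. f z ^ i * h z)"
    using assms by (auto simp: power_mult_def)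
  then have "(\<lambda>z. v z + w z) = (\<lambda>z. f z ^ i * (g z + h z))"
    by (auto simp: algebra_simps)
  then show ?thesis unfolding power_mult_def using smooth_add gh by blast
qed

lemma power_mult_cmult:
  assumes "v \<in> power_mult f i"
  shows "(\<lambda>z. c * v z) \<in> power_mult f i"
proof -
  obtain g where g: "smooth g" "v = (\<lambda>z. f z ^ i * g z)"
    using assms by (auto simp: power_mult_def)
  then have "(\<lambda>z. c * v z) = (\<lambda>z. f z ^ i * (c * g z))"
    by (auto simp: algebra_simps)
  then show ?thesis unfolding power_mult_def using smooth_cmult g by blast
qed

lemma power_mult_sum:
  assumes "finite I" "\<And>j. j \<in> I \<Longrightarrow> w j \<in> power_mult f i"
  shows "(\<lambda>z. \<Sum>j\<in>I. w j z) \<in> power_mult f i"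
  using assms
proof (induction I rule: finite_induct)
  case empty
  have "(\<lambda>z. 0) = (\<lambda>z. f z ^ i * 0)" by simp
  then show ?case unfolding power_mult_def using smooth_const[of 0] by auto
next
  case (insert j I)
  then show ?case using power_mult_add[of "w j"] by simp
qed

lemma power_mult_weaken:
  assumes "smooth f" "w \<in> power_mult f (l + i)"
  shows "w \<in> power_mult f i"
proof -
  obtain g where g: "smooth g" "w = (\<lambda>z. f z ^ (l + i) * g z)"
    using assms by (auto simp: power_mult_def)
  then have "w = (\<lambda>z. f z ^ i * (f z ^ l * g z))"
    by (auto simp: power_add algebra_simps)
  then show ?thesis
    unfolding power_mult_def using smooth_mult[OF smooth_power[OF assms(1)] g(1)] by blast
qed

text \<open>The product rule gives f^i (f \<partial>g + (i + 1) \<partial>f g): each derivative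
  costs exactly one power of \<open>f\<close>, so an operator of order l costs l powers.\<close>

lemma power_mult_partial:
  assumes "smooth f" "w \<in> power_mult f (Suc i)" "b \<in> Basis"
  shows "partial b w \<in> power_mult f i"
proof -
  obtain g where g: "smooth g" "w = (\<lambda>z. f z ^ Suc i * g z)"
    using assms by (auto simp: power_mult_def)
  have d: "g differentiable (at z)" "f differentiable (at z)" for z
    using smooth_differentiable assms g by auto
  have "partial b w z = f z ^ i * (f z * partial b g z + (1 + real i) * (partial b f z * g z))" for z
  proof -
    obtain f' where f': "(f has_derivative f') (at z)" "\<And>b. partial b f z = f' b"
      using has_derivative_partial d by metis
    have "partial b (\<lambda>z. f z ^ Suc i) z = (1 + real i) * (f z ^ i * partial b f z)"
      using partial_eqI[OF has_derivative_power[OF f'(1), of "Suc i"]] f' by (simp add: algebra_simps)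
    moreover have "(\<lambda>z. f z ^ Suc i) differentiable (at z)"
      using d by (intro derivative_intros)
    ultimately show ?thesis
      using partial_mult[of "\<lambda>z. f z ^ Suc i" z g b] d g(2) by (simp add: algebra_simps)
  qed
  moreover have "smooth (\<lambda>z. f z * partial b g z + (1 + real i) * (partial b f z * g z))"
    using assms g by (intro smooth_add smooth_mult smooth_const smooth_partial)
  ultimately show ?thesis unfolding power_mult_def by blast
qed

lemma time_Basis: "(0, 1 :: real) \<in> Basis"
  and space_Basis: "b \<in> Basis \<Longrightarrow> (b, 0 :: real) \<in> Basis"
  by (auto simp: Basis_prod_def)

lemma power_mult_dt:
  assumes "smooth f" "w \<in> power_mult f (l + i)"
  shows "(dt ^^ l) w \<in> power_mult f i"
  using assms(2)
proof (induction l arbitrary: i)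
  case (Suc l)
  then have "(dt ^^ l) w \<in> power_mult f (Suc i)" by simp
  then show ?case unfolding dt_def using power_mult_partial[OF assms(1) _ time_Basis] by simp
qed simp

lemma power_mult_polyharmonic:
  assumes "smooth f" "w \<in> power_mult f (2 * l + i)"
  shows "polyharmonic l w \<in> power_mult f i"
  using assms(2)
proof (induction l arbitrary: i)
  case (Suc l)
  then have "polyharmonic l w \<in> power_mult f (Suc (Suc i))" by simp
  then have "partial (b, 0) (partial (b, 0) (polyharmonic l w)) \<in> power_mult f i" if "b \<in> Basis" for b
    using power_mult_partial[OF assms(1) _ space_Basis[OF that]] by blast
  then have "(\<lambda>z. -1 * laplace_x (polyharmonic l w) z) \<in> power_mult f i"
    unfolding laplace_x_def[abs_def] by (intro power_mult_cmult power_mult_sum) auto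
  then show ?case by (simp add: polyharmonic_def)
qed (simp add: polyharmonic_def)

lemma smooth_dt: "smooth f \<Longrightarrow> smooth ((dt ^^ l) f)"
  by (induction l) (auto simp: dt_def smooth_partial time_Basis)

lemma smooth_laplace_x: "smooth f \<Longrightarrow> smooth (laplace_x f)"
  unfolding laplace_x_def[abs_def] by (intro smooth_sum smooth_partial space_Basis) auto

lemma smooth_polyharmonic: "smooth f \<Longrightarrow> smooth (polyharmonic l f)"
proof (induction l)
  case (Suc l)
  then have "smooth (\<lambda>z. -1 * laplace_x (polyharmonic l f) z)"
    by (intro smooth_cmult smooth_laplace_x) auto
  then show ?case by (simp add: polyharmonic_def)
qed (simp add: polyharmonic_def)

text \<open>Constancy is demanded along the line through \<open>z\<close> in direction
  \<open>b\<close> alone, so that the lemma also covers functions that vary in x but not in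
  t.\<close>

lemma partial_eq_0:
  assumes "f differentiable (at z)" "open S" "z \<in> S"
    and "\<And>h. z + h *\<^sub>R b \<in> S \<Longrightarrow> f (z + h *\<^sub>R b) = f z"
  shows "partial b f z = 0"
proof -
  obtain f' where f': "(f has_derivative f') (at z)" "partial b f z = f' b"
    using has_derivative_partial assms(1) by metis
  have "((\<lambda>h. f (z + h *\<^sub>R b)) has_derivative (\<lambda>h. f' (h *\<^sub>R b))) (at 0)"
    by (rule has_derivative_compose[of "\<lambda>h. z + h *\<^sub>R b" "\<lambda>h. h *\<^sub>R b" 0 UNIV f f'])
      (use f' in \<open>auto intro!: derivative_eq_intros\<close>)
  moreover have "((\<lambda>h. f (z + h *\<^sub>R b)) has_derivative (\<lambda>h. 0)) (at (0::real))"
  proof (rule has_derivative_transform_within_open[of "\<lambda>h. f z" _ _ _ "(\<lambda>h. z + h *\<^sub>R b) -` S"])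
    show "open ((\<lambda>h. z + h *\<^sub>R b) -` S)"
      using assms(2) by (intro open_vimage) (auto intro!: continuous_intros)
  qed (use assms in auto)
  ultimately have "(\<lambda>h. f' (h *\<^sub>R b)) = (\<lambda>h. 0)"
    by (rule has_derivative_unique)
  then show ?thesis using f' by (metis scaleR_one)
qed

lemma partial_eq_0_const:
  assumes "open S" "\<And>z. z \<in> S \<Longrightarrow> f z = c" "z \<in> S" "smooth f"
  shows "partial b f z = 0"
  using partial_eq_0[of f z S b] assms smooth_differentiable by auto

lemma dt_funpow_eq_0:
  assumes "open S" "smooth f" "\<And>z. z \<in> S \<Longrightarrow> dt f z = 0" "z \<in> S"
  shows "(dt ^^ Suc l) f z = 0"
  using assms(4)
proof (induction l arbitrary: z)
  case (Suc l)
  show ?case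
    using partial_eq_0_const[OF assms(1) Suc.IH _ smooth_dt[OF assms(2)]] Suc.prems
    by (simp add: dt_def)
qed (use assms in auto)

lemma polyharmonic_eq_0:
  assumes "open S" "smooth f" "\<And>z. z \<in> S \<Longrightarrow> f z = c" "z \<in> S"
  shows "polyharmonic (Suc l) f z = 0"
  using assms(4)
proof -
  have *: "laplace_x g z = 0" if "smooth g" "\<And>z. z \<in> S \<Longrightarrow> g z = c" "z \<in> S" for g z c
    unfolding laplace_x_def
    using partial_eq_0_const[OF assms(1) _ _ smooth_partial[OF that(1) space_Basis], of _ 0]
      partial_eq_0_const[OF assms(1) that(2) _ that(1)] that(3)
    by (intro sum.neutral) auto
  have "polyharmonic (Suc l) f z = 0" if "z \<in> S" for z
    using that
  proof (induction l arbitrary: z)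
    case 0
    then show ?case using *[OF assms(2,3)] by (simp add: polyharmonic_def)
  next
    case (Suc l)
    then show ?case using *[OF smooth_polyharmonic[OF assms(2)] Suc.IH, of z]
      by (simp add: polyharmonic_def)
  qed
  then show ?thesis using assms by blast
qed

section \<open>Behaviour under dilations acting differently on space and time\<close>

definition rescale :: "real \<Rightarrow> real \<Rightarrow> 'a::euclidean_space \<times> real \<Rightarrow> 'a \<times> real" where
  "rescale a b z = (a *\<^sub>R fst z, b * snd z)"

lemma rescale_partial:
  assumes "w differentiable (at (rescale a b z))"
  shows "partial (0, 1) (\<lambda>z. w (rescale a b z)) z = b * partial (0, 1) w (rescale a b z)"
    and "partial (c, 0) (\<lambda>z. w (rescale a b z)) z = a * partial (c, 0) w (rescale a b z)"
    and "(\<lambda>z. w (rescale a b z)) differentiable (at z)"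
proof -
  obtain w' where w': "(w has_derivative w') (at (rescale a b z))"
    "\<And>b'. partial b' w (rescale a b z) = w' b'"
    using has_derivative_partial assms by metis
  have "(rescale a b has_derivative rescale a b) (at z)"
    unfolding rescale_def[abs_def] by (auto intro!: derivative_eq_intros)
  from has_derivative_compose[OF this w'(1)]
  have d: "((\<lambda>z. w (rescale a b z)) has_derivative (\<lambda>h. w' (rescale a b h))) (at z)" .
  have l: "linear w'" using w'(1) has_derivative_linear by blast
  have "rescale a b (0, 1) = b *\<^sub>R (0, 1)" "rescale a b (c, 0) = a *\<^sub>R (c, 0)"
    by (auto simp: rescale_def)
  then show "partial (0, 1) (\<lambda>z. w (rescale a b z)) z = b * partial (0, 1) w (rescale a b z)"
    "partial (c, 0) (\<lambda>z. w (rescale a b z)) z = a * partial (c, 0) w (rescale a b z)"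
    using partial_eqI[OF d] w'(2) linear_cmul[OF l] by (metis real_scaleR_def)+
  show "(\<lambda>z. w (rescale a b z)) differentiable (at z)"
    using d differentiable_def by blast
qed

text \<open>A partial derivative of a rescaled function is a constant times a rescaled partial
  derivative, so the induction stays among rescaled smooth functions.\<close>

lemma smooth_rescale:
  fixes w :: "'a::euclidean_space \<times> real \<Rightarrow> real"
  assumes "smooth w"
  shows "smooth (\<lambda>z. w (rescale a b z))"
proof -
  have "Ck j (\<lambda>z. w (rescale a b z))" for j
    using assms
  proof (induction j arbitrary: w)
    case 0
    have "continuous_on UNIV (rescale a b)"
      unfolding rescale_def[abs_def] by (intro continuous_intros)
    then show ?case using continuous_on_compose2[OF smooth_continuous[OF 0]] by auto
  next
    case (Suc j)
    note d = rescale_partial[OF smooth_differentiable[OF Suc.prems], where a = a and b = b]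
    have "Ck j (partial e (\<lambda>z. w (rescale a b z)))" if "e \<in> Basis" for e
    proof -
      consider c where "c \<in> Basis" "e = (c, 0)" | "e = (0, 1)"
        using \<open>e \<in> Basis\<close> by (auto simp: Basis_prod_def)
      then have "\<exists>r. partial e (\<lambda>z. w (rescale a b z)) = (\<lambda>z. r * partial e w (rescale a b z))"
        using d(1,2) by cases blast+
      then show ?thesis
        using Suc.IH[OF smooth_partial[OF Suc.prems that]] Ck_mult[OF Ck_const] by fastforce
    qed
    then show ?case using d(3) by (auto simp: differentiable_on_def intro: differentiable_at_withinI)
  qed
  then show ?thesis by (simp add: smooth_def)
qed

lemma partial_cmult:
  assumes "smooth f"
  shows "partial e (\<lambda>z. c * f z) z = c * partial e f z"
  using partial_mult[of "\<lambda>z. c" z f e] smooth_differentiable[OF smooth_const]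
    smooth_differentiable[OF assms]
  by (simp add: partial_const)

lemma dt_rescale:
  assumes "smooth w"
  shows "(dt ^^ l) (\<lambda>z. w (rescale a b z)) = (\<lambda>z. b ^ l * (dt ^^ l) w (rescale a b z))"
proof (induction l)
  case (Suc l)
  have "partial (0, 1) (\<lambda>z. b ^ l * (dt ^^ l) w (rescale a b z)) z
      = b ^ Suc l * partial (0, 1) ((dt ^^ l) w) (rescale a b z)" for z
    using rescale_partial(1)[OF smooth_differentiable[OF smooth_dt[OF assms, of l]]]
    by (simp add: partial_cmult smooth_rescale smooth_dt assms)
  then show ?case using Suc by (simp add: dt_def)
qed simp

lemma laplace_x_rescale:
  assumes "smooth w"
  shows "laplace_x (\<lambda>z. r * w (rescale a b z)) = (\<lambda>z. r * a\<^sup>2 * laplace_x w (rescale a b z))"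
proof -
  have "partial (e, 0) (partial (e, 0) (\<lambda>z. r * w (rescale a b z))) z
      = r * a\<^sup>2 * partial (e, 0) (partial (e, 0) w) (rescale a b z)" if "e \<in> Basis" for e z
  proof -
    have "partial (e, 0) (\<lambda>z. r * w (rescale a b z)) = (\<lambda>z. (r * a) * partial (e, 0) w (rescale a b z))"
      using partial_cmult[OF smooth_rescale[OF assms]]
        rescale_partial(2)[OF smooth_differentiable[OF assms]] by auto
    then show ?thesis
      using smooth_partial[OF assms space_Basis[OF that]]
      by (simp add: partial_cmult smooth_rescale rescale_partial(2) smooth_differentiable power2_eq_square)
  qed
  then show ?thesis by (auto simp: laplace_x_def sum_distrib_left)
qed

lemma polyharmonic_rescale:
  assumes "smooth w"
  shows "polyharmonic l (\<lambda>z. w (rescale a b z)) = (\<lambda>z. a ^ (2 * l) * polyharmonic l w (rescale a b z))"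
proof (induction l)
  case (Suc l)
  have "polyharmonic (Suc l) (\<lambda>z. w (rescale a b z))
      = (\<lambda>z. - laplace_x (\<lambda>z. a ^ (2 * l) * polyharmonic l w (rescale a b z)) z)"
    using Suc by (simp add: polyharmonic_def)
  then show ?case
    using laplace_x_rescale[OF smooth_polyharmonic[OF assms]]
    by (simp add: polyharmonic_def power2_eq_square algebra_simps)
qed (simp add: polyharmonic_def)

subsection \<open>The test function\<close>

text \<open>Squares are fed to the cutoff since they are smooth at the origin, unlike the norm; the
  thresholds 1 and 4 of \<open>cutoff\<close> thus become the radii 1 and 2.\<close>

definition bump :: "'a::euclidean_space \<times> real \<Rightarrow> real" where
  "bump z = cutoff (fst z \<bullet> fst z) * cutoff (snd z * snd z)"

lemma smooth_bump: "smooth bump"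
proof -
  have "smooth (\<lambda>z::'a \<times> real. \<Sum>b\<in>Basis. (fst z \<bullet> b) * (fst z \<bullet> b))"
    by (intro smooth_sum smooth_mult smooth_linear bounded_linear_intros)
  then have "smooth (\<lambda>z::'a \<times> real. fst z \<bullet> fst z)"
    by (simp add: euclidean_inner[of "fst _" "fst _"])
  moreover have "smooth (\<lambda>z::'a \<times> real. snd z * snd z)"
    by (intro smooth_mult smooth_linear bounded_linear_snd)
  ultimately show ?thesis
    unfolding bump_def[abs_def] by (rule smooth_mult[OF smooth_cutoff smooth_cutoff])
qed

lemma bump_nonneg: "0 \<le> bump z"
  and bump_le_1: "bump z \<le> 1"
  by (simp_all add: bump_def cutoff_nonneg cutoff_le_1 mult_le_one)

lemma bump_eq_1:
  assumes "norm (fst z) \<le> 1" "\<bar>snd z\<bar> \<le> 1"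
  shows "bump z = 1"
proof -
  have "fst z \<bullet> fst z \<le> 1"
    using assms(1) by (simp add: dot_square_norm power_le_one)
  moreover have "snd z * snd z \<le> 1"
    using assms(2) by (metis abs_square_le_1 power2_eq_square)
  ultimately show ?thesis
    by (simp add: bump_def cutoff_eq_1)
qed

lemma bump_support:
  assumes "bump z \<noteq> 0"
  shows "norm (fst z) < 2" "\<bar>snd z\<bar> < 2"
proof -
  have "\<not> 4 \<le> fst z \<bullet> fst z" "\<not> 4 \<le> snd z * snd z"
    using assms cutoff_eq_0 by (auto simp: bump_def)
  then have "(norm (fst z))\<^sup>2 < 2\<^sup>2" "\<bar>snd z\<bar>\<^sup>2 < 2\<^sup>2"
    by (auto simp: dot_square_norm power2_eq_square)
  then show "norm (fst z) < 2" "\<bar>snd z\<bar> < 2"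
    using power_less_imp_less_base by fastforce+
qed

text \<open>The smooth cofactor is bounded on a compact set off which \<open>bump\<close> vanishes.
  There \<open>i \<ge> 1\<close> matters, as \<open>0 ^ 0 = 1\<close>.\<close>

lemma power_mult_bump_bound:
  assumes "w \<in> power_mult bump i" "i \<ge> 1"
  shows "\<exists>C\<ge>0. \<forall>z::'a::euclidean_space \<times> real. \<bar>w z\<bar> \<le> C * bump z ^ i"
proof -
  obtain g where g: "smooth g" "w = (\<lambda>z. bump z ^ i * g z)"
    using assms by (auto simp: power_mult_def)
  define X where "X = (cball 0 2 :: 'a set) \<times> {-2..2::real}"
  have "compact (g ` X)"
    unfolding X_def using smooth_continuous[OF g(1)]
    by (intro compact_continuous_image compact_Times) (auto intro: continuous_on_subset)
  then obtain C where C: "\<And>z. z \<in> X \<Longrightarrow> \<bar>g z\<bar> \<le> C"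
    unfolding compact_eq_bounded_closed bounded_iff by auto
  have "\<bar>w z\<bar> \<le> max C 0 * bump z ^ i" for z
  proof (cases "bump z = 0")
    case True
    then show ?thesis using g(2) assms(2) by (simp add: zero_power)
  next
    case False
    then have "z \<in> X"
      using bump_support[OF False] by (auto simp: X_def mem_Times_iff)
    then have "\<bar>g z\<bar> \<le> max C 0" using C by fastforce
    then show ?thesis
      using bump_nonneg[of z] g(2) by (simp add: abs_mult mult.commute mult_right_mono)
  qed
  then show ?thesis by (metis max.cobounded2)
qed

lemma test_function:
  assumes "m \<ge> 1" "k \<ge> 1" "0 < \<theta>" "\<theta> < 1"
  obtains \<phi> :: "'a::euclidean_space \<times> real \<Rightarrow> real" and C where
    "smooth \<phi>" "\<And>z. 0 \<le> \<phi> z" "\<And>z. \<phi> z \<le> 1" "C > 0"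
    "\<And>z. norm (fst z) \<le> 1 \<Longrightarrow> \<bar>snd z\<bar> \<le> 1 \<Longrightarrow> \<phi> z = 1"
    "\<And>z. \<phi> z \<noteq> 0 \<Longrightarrow> norm (fst z) < 2 \<and> \<bar>snd z\<bar> < 2"
    "\<And>l x. (dt ^^ Suc l) \<phi> (x, 0) = 0"
    "\<And>z. \<bar>(dt ^^ k) \<phi> z\<bar> + \<bar>polyharmonic m \<phi> z\<bar> \<le> C * \<phi> z powr \<theta>"
    "\<And>z. norm (fst z) < 1 \<Longrightarrow> \<bar>snd z\<bar> < 1 \<Longrightarrow> (dt ^^ k) \<phi> z = 0 \<and> polyharmonic m \<phi> z = 0"
proof -
  \<comment> \<open>The bound \<theta> (k + 2m + i) \<le> i holds once i \<ge> \<theta> (k + 2m) /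
    (1 - \<theta>). As \<open>bump\<close> lies between 0 and 1, it gives
    \<open>bump z ^ i \<le> \<phi> z powr \<theta>\<close>: the power left after differentiation
    still dominates. \<open>Suc\<close> secures i \<ge> 1.\<close>
  define i where "i = Suc (nat \<lceil>\<theta> * (k + 2 * m) / (1 - \<theta>)\<rceil>)"
  have i1: "i \<ge> 1" by (simp add: i_def)
  have "\<theta> * (k + 2 * m) / (1 - \<theta>) \<le> i"
    unfolding i_def by linarith
  then have i: "\<theta> * (k + 2 * m + i) \<le> i"
    using assms by (simp add: field_simps)
  define \<kappa> where "\<kappa> = k + 2 * m + i"
  define \<phi> :: "'a \<times> real \<Rightarrow> real" where "\<phi> z = bump z ^ \<kappa>" for z
  have k1: "\<kappa> \<ge> 1" using i1 by (simp add: \<kappa>_def)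
  have sm: "smooth \<phi>"
    unfolding \<phi>_def[abs_def] by (intro smooth_power smooth_bump)
  have pm: "\<phi> \<in> power_mult bump \<kappa>"
    unfolding power_mult_def \<phi>_def[abs_def] using smooth_const[of 1] by force
  have "(dt ^^ k) \<phi> \<in> power_mult bump i"
    by (rule power_mult_weaken[OF smooth_bump, of _ "2 * m"], rule power_mult_dt[OF smooth_bump])
      (use pm in \<open>simp add: \<kappa>_def add.assoc\<close>)
  then obtain C1 where C1: "C1 \<ge> 0" "\<And>z. \<bar>(dt ^^ k) \<phi> z\<bar> \<le> C1 * bump z ^ i"
    using power_mult_bump_bound i1 by blast
  have "polyharmonic m \<phi> \<in> power_mult bump i"
    by (rule power_mult_weaken[OF smooth_bump, of _ k], rule power_mult_polyharmonic[OF smooth_bump])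
      (use pm in \<open>simp add: \<kappa>_def ac_simps\<close>)
  then obtain C2 where C2: "C2 \<ge> 0" "\<And>z. \<bar>polyharmonic m \<phi> z\<bar> \<le> C2 * bump z ^ i"
    using power_mult_bump_bound i1 by blast
  have pw: "bump z ^ i \<le> \<phi> z powr \<theta>" for z :: "'a \<times> real"
  proof (cases "bump z = 0")
    case False
    then have p: "bump z > 0" using bump_nonneg[of z] by linarith
    then have "\<phi> z powr \<theta> = bump z powr (\<theta> * \<kappa>)"
      by (simp add: \<phi>_def powr_powr mult.commute flip: powr_realpow)
    moreover have "bump z powr i \<le> bump z powr (\<theta> * \<kappa>)"
      using p bump_le_1[of z] i by (intro powr_mono') (auto simp: \<kappa>_def)
    ultimately show ?thesis using p by (simp add: powr_realpow)
  qed (use i1 in \<open>simp add: zero_power\<close>)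
  define Q :: "('a \<times> real) set" where "Q = ball 0 1 \<times> {-1<..<1}"
  have Q: "open Q" by (auto simp: Q_def intro: open_Times)
  have memQ: "z \<in> Q \<longleftrightarrow> norm (fst z) < 1 \<and> \<bar>snd z\<bar> < 1" for z
    by (cases z) (auto simp: Q_def)
  have one: "\<phi> z = 1" if "norm (fst z) \<le> 1" "\<bar>snd z\<bar> \<le> 1" for z
    using bump_eq_1[OF that] by (simp add: \<phi>_def)
  have dQ: "dt \<phi> z = 0" if "z \<in> Q" for z
    unfolding dt_def by (rule partial_eq_0_const[OF Q _ that sm, of 1]) (auto simp: memQ one)
  \<comment> \<open>For \<bar>t\<bar> < 1 the time factor of \<open>bump\<close> is 1 for every x;
    this kills all time derivatives at t = 0, even where the space factor is not constant.\<close>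
  have dt0: "dt \<phi> z = 0" if "z \<in> UNIV \<times> {-1<..<1}" for z
    unfolding dt_def
  proof (rule partial_eq_0[OF smooth_differentiable[OF sm], of "UNIV \<times> {-1<..<1}"])
    fix h assume "z + h *\<^sub>R (0, 1) \<in> UNIV \<times> {-1<..<1}"
    then have "(snd z + h) * (snd z + h) \<le> 1" "snd z * snd z \<le> 1"
      using that by (auto simp: abs_square_le_1 mem_Times_iff simp flip: power2_eq_square)
    then show "\<phi> (z + h *\<^sub>R (0, 1)) = \<phi> z"
      by (simp add: \<phi>_def bump_def cutoff_eq_1)
  qed (use that in \<open>auto intro: open_Times\<close>)
  show ?thesis
  proof
    show "smooth \<phi>" by fact
    show "0 \<le> \<phi> z" "\<phi> z \<le> 1" for z
      by (auto simp: \<phi>_def bump_nonneg bump_le_1 power_le_one)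
    show "C1 + C2 + 1 > 0" using C1 C2 by simp
    show "\<phi> z = 1" if "norm (fst z) \<le> 1" "\<bar>snd z\<bar> \<le> 1" for z
      using one that .
    show "norm (fst z) < 2 \<and> \<bar>snd z\<bar> < 2" if "\<phi> z \<noteq> 0" for z
      using that bump_support[of z] k1 by (auto simp: \<phi>_def)
    show "(dt ^^ Suc l) \<phi> (x, 0) = 0" for l x
      by (rule dt_funpow_eq_0[OF _ sm dt0, of "UNIV \<times> {-1<..<1}"]) (auto intro: open_Times)
    show "\<bar>(dt ^^ k) \<phi> z\<bar> + \<bar>polyharmonic m \<phi> z\<bar> \<le> (C1 + C2 + 1) * \<phi> z powr \<theta>" for z
    proof -
      have "\<bar>(dt ^^ k) \<phi> z\<bar> + \<bar>polyharmonic m \<phi> z\<bar> \<le> (C1 + C2) * bump z ^ i"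
        using C1(2)[of z] C2(2)[of z] by (simp add: algebra_simps)
      also have "\<dots> \<le> (C1 + C2) * \<phi> z powr \<theta>"
        using C1 C2 pw by (intro mult_left_mono) auto
      also have "\<dots> \<le> (C1 + C2 + 1) * \<phi> z powr \<theta>"
        by (intro mult_right_mono) auto
      finally show ?thesis .
    qed
    show "(dt ^^ k) \<phi> z = 0 \<and> polyharmonic m \<phi> z = 0" if "norm (fst z) < 1" "\<bar>snd z\<bar> < 1" for z
    proof -
      have "z \<in> Q" using that by (simp add: memQ)
      moreover obtain k' m' where "k = Suc k'" "m = Suc m'"
        using assms by (metis Suc_le_D One_nat_def)
      ultimately show ?thesis
        using dt_funpow_eq_0[OF Q sm dQ] polyharmonic_eq_0[OF Q sm, of 1] by (auto simp: memQ one)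
    qed
  qed
qed

subsection \<open>Energies on time slices\<close>

lemma nn_integral_time_slices:
  assumes "f \<in> borel_measurable (borel :: ('a::euclidean_space \<times> real) measure)"
  shows "(\<integral>\<^sup>+z. f z \<partial>lborel) = (\<integral>\<^sup>+t. (\<integral>\<^sup>+x. f (x, t) \<partial>lborel) \<partial>lborel)"
proof -
  have "f \<in> borel_measurable ((lborel :: 'a measure) \<Otimes>\<^sub>M (lborel :: real measure))"
    using assms by (simp add: lborel_prod)
  from lborel_pair.nn_integral_snd[OF this] show ?thesis
    by (simp add: lborel_prod)
qed

lemma borel_measurable_time_slice [measurable]:
  assumes "f \<in> borel_measurable (borel :: ('a::euclidean_space \<times> real) measure)"
  shows "(\<lambda>t. \<integral>\<^sup>+x. f (x, t) \<partial>lborel) \<in> borel_measurable borel"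
proof -
  have "(\<lambda>(t, x). f (x, t)) \<in> borel_measurable ((borel :: real measure) \<Otimes>\<^sub>M (lborel :: 'a measure))"
    using assms unfolding borel_prod[symmetric] by measurable
  then show ?thesis
    using lborel.borel_measurable_nn_integral[of "\<lambda>t x. f (x, t)"] by simp
qed

lemma borel_measurable_slice:
  fixes f :: "'a::euclidean_space \<times> real \<Rightarrow> 'c::topological_space"
  assumes "f \<in> borel_measurable borel"
  shows "(\<lambda>x. f (x, t)) \<in> borel_measurable borel"
  by (rule measurable_compose[OF _ assms]) (simp add: borel_prod[symmetric])

lemma AE_time_slices:
  assumes "AE z in (lborel :: ('a::euclidean_space \<times> real) measure). P z"
  shows "AE t in lborel. AE x in lborel. P (x, t)"
proof -
  from AE_E[OF assms] obtain N
    where "{z \<in> space lborel. \<not> P z} \<subseteq> N" "emeasure lborel N = 0" "N \<in> sets lborel" .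
  then have N: "N \<in> sets borel" "emeasure lborel N = 0" "{z. \<not> P z} \<subseteq> N"
    by simp_all
  have "(\<integral>\<^sup>+t. (\<integral>\<^sup>+x. indicator N (x, t) \<partial>lborel) \<partial>lborel) = emeasure lborel N"
    using nn_integral_time_slices[of "indicator N"] N(1) by simp
  moreover have "(\<lambda>t. \<integral>\<^sup>+x. indicator N (x, t) \<partial>lborel) \<in> borel_measurable lborel"
    using N(1) by measurable
  ultimately have "AE t in lborel. (\<integral>\<^sup>+x. indicator N (x, t) \<partial>lborel) = 0"
    using N(2) by (simp add: nn_integral_0_iff_AE)
  then show ?thesis
  proof eventually_elim
    case (elim t)
    have "(\<lambda>x. indicator N (x, t) :: ennreal) \<in> borel_measurable lborel"
      using borel_measurable_slice[of "indicator N"] N(1) by simp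
    then have "AE x in lborel. indicator N (x, t) = (0 :: ennreal)"
      using elim by (simp add: nn_integral_0_iff_AE)
    then show ?case
      by eventually_elim (use N(3) in \<open>auto simp: indicator_def split: if_splits\<close>)
  qed
qed

text \<open>The exceptional set is a cylinder over a null set of times, whose measure is \<infinity>
  * 0 = 0.\<close>

lemma AE_time_lift:
  assumes "AE t in lborel. P t"
  shows "AE z in (lborel :: ('a::euclidean_space \<times> real) measure). P (snd z)"
proof -
  from AE_E[OF assms] obtain N
    where "{t \<in> space lborel. \<not> P t} \<subseteq> N" "emeasure lborel N = 0" "N \<in> sets lborel" .
  then have N: "N \<in> sets borel" "emeasure lborel N = 0" "{t. \<not> P t} \<subseteq> N"
    by simp_all
  have "emeasure (lborel :: ('a \<times> real) measure) (UNIV \<times> N)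
      = emeasure (lborel :: 'a measure) UNIV * emeasure lborel N"
    unfolding lborel_prod[symmetric]
    by (rule lborel.emeasure_pair_measure_Times) (use N in auto)
  also have "\<dots> = 0" using N by simp
  finally have "emeasure (lborel :: ('a \<times> real) measure) (UNIV \<times> N) = 0" .
  moreover have "UNIV \<times> N \<in> sets (borel :: ('a \<times> real) measure)"
    unfolding borel_prod[symmetric] using N by (intro pair_measureI) auto
  ultimately show ?thesis
    using N(3) by (intro AE_I[of _ _ "UNIV \<times> N"]) auto
qed

lemma upper_half_borel [measurable]: "upper_half \<in> sets borel"
  by (simp add: upper_half_def open_Times)

text \<open>Slices of a Lebesgue measurable function need not be measurable, those of a Borel
  function are. Setting the representative to 0 off the half-space lets later integrals run over the
  whole space.\<close>

lemma borel_representative: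
  fixes w :: "'a::euclidean_space \<times> real \<Rightarrow> real"
  assumes "set_borel_measurable lebesgue upper_half w"
  obtains w' where "w' \<in> borel_measurable borel" "\<And>z. z \<notin> upper_half \<Longrightarrow> w' z = 0"
    "AE z in lborel. z \<in> upper_half \<longrightarrow> w z = w' z"
proof -
  obtain g where g: "g \<in> borel_measurable lborel"
      "AE z in lborel. indicator upper_half z *\<^sub>R w z = g z"
    using completion_ex_borel_measurable_real[OF assms[unfolded set_borel_measurable_def]] by blast
  show ?thesis
  proof
    show "(\<lambda>z. indicator upper_half z * g z) \<in> borel_measurable borel"
      using g(1) by measurable
    show "AE z in lborel. z \<in> upper_half \<longrightarrow> w z = indicator upper_half z * g z"
      using g(2) by eventually_elim auto
  qed auto
qed

text \<open>The square of the norm of g \<bar>w\<bar>^c in L^2 in time with values in L^1 in space.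
  Values in \<open>ennreal\<close> leave finiteness as something to be proved.\<close>

definition energy ::
    "real \<Rightarrow> ('a::euclidean_space \<times> real \<Rightarrow> real) \<Rightarrow> ('a \<times> real \<Rightarrow> real) \<Rightarrow> ennreal" where
  "energy c w g = (\<integral>\<^sup>+t. (\<integral>\<^sup>+x. ennreal (g (x, t) * \<bar>w (x, t)\<bar> powr c) \<partial>lborel)\<^sup>2 \<partial>lborel)"

lemma energy_mono:
  assumes "\<And>z. g z \<le> h z"
  shows "energy c w g \<le> energy c w h"
  unfolding energy_def using assms
  by (intro nn_integral_mono power_mono ennreal_leI mult_right_mono) auto

text \<open>On each slice a^2 + b^2 \<le> (a + b)^2 for a, b \<ge> 0. This splits the energy into a
  core and an outer part in spite of the square.\<close>

lemma energy_superadditive: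
  assumes [measurable]: "w \<in> borel_measurable borel" "g \<in> borel_measurable borel" "h \<in> borel_measurable borel"
    and nn: "\<And>z. 0 \<le> g z" "\<And>z. 0 \<le> h z"
  shows "energy c w g + energy c w h \<le> energy c w (\<lambda>z. g z + h z)"
proof -
  have "energy c w g + energy c w h =
      (\<integral>\<^sup>+t. (\<integral>\<^sup>+x. ennreal (g (x, t) * \<bar>w (x, t)\<bar> powr c) \<partial>lborel)\<^sup>2
        + (\<integral>\<^sup>+x. ennreal (h (x, t) * \<bar>w (x, t)\<bar> powr c) \<partial>lborel)\<^sup>2 \<partial>lborel)"
    unfolding energy_def by (rule nn_integral_add[symmetric]; measurable)
  also have "\<dots> \<le> (\<integral>\<^sup>+t. ((\<integral>\<^sup>+x. ennreal (g (x, t) * \<bar>w (x, t)\<bar> powr c) \<partial>lborel)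
        + (\<integral>\<^sup>+x. ennreal (h (x, t) * \<bar>w (x, t)\<bar> powr c) \<partial>lborel))\<^sup>2 \<partial>lborel)"
    by (intro nn_integral_mono) (simp add: power2_eq_square distrib_left distrib_right add_increasing2 add_increasing add_mono)
  also have "\<dots> = energy c w (\<lambda>z. g z + h z)"
    unfolding energy_def using nn
    by (subst nn_integral_add[symmetric])
      (auto intro!: borel_measurable_slice[of "\<lambda>z. ennreal (_ z * \<bar>w z\<bar> powr c)"] simp: distrib_right ennreal_plus)
  finally show ?thesis .
qed

lemma AE_eq_0_if_energy_eq_0:
  assumes [measurable]: "w \<in> borel_measurable borel" and "c > 0" and "energy c w (\<lambda>z. 1) = 0"
  shows "AE z in lborel. w z = 0"
proof -
  have "AE t in lborel. (\<integral>\<^sup>+x. ennreal (\<bar>w (x, t)\<bar> powr c) \<partial>lborel)\<^sup>2 = 0"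
    using assms(3) unfolding energy_def by (subst (asm) nn_integral_0_iff_AE) auto
  then have "AE t in lborel. (\<integral>\<^sup>+x. ennreal (\<bar>w (x, t)\<bar> powr c) \<partial>lborel) = 0"
    by eventually_elim simp
  then have "(\<integral>\<^sup>+t. (\<integral>\<^sup>+x. ennreal (\<bar>w (x, t)\<bar> powr c) \<partial>lborel) \<partial>lborel) = 0"
    by (subst nn_integral_0_iff_AE) auto
  then have "(\<integral>\<^sup>+z. ennreal (\<bar>w z\<bar> powr c) \<partial>lborel) = 0"
    using nn_integral_time_slices[of "\<lambda>z. ennreal (\<bar>w z\<bar> powr c)"] by simp
  then have "AE z in lborel. ennreal (\<bar>w z\<bar> powr c) = 0"
    by (subst (asm) nn_integral_0_iff_AE) auto
  then show ?thesis by eventually_elim simp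
qed

text \<open>Monotone convergence is used twice, on slices and then in time, along integer radii;
  monotonicity of \<open>Q\<close> passes from these to all large real radii.\<close>

lemma energy_exhaustion:
  fixes Q :: "real \<Rightarrow> ('a::euclidean_space \<times> real) set"
  assumes [measurable]: "w \<in> borel_measurable borel" "\<And>R. Q R \<in> sets borel"
    and mono: "\<And>R S. 0 \<le> R \<Longrightarrow> R \<le> S \<Longrightarrow> Q R \<subseteq> Q S" and UN: "\<And>z. \<exists>R\<ge>0. z \<in> Q R"
  shows "((\<lambda>R. energy c w (indicator (Q R))) \<longlongrightarrow> energy c w (\<lambda>z. 1)) at_top"
proof (rule order_tendstoI)
  fix a assume a: "a < energy c w (\<lambda>z. 1)"
  let ?f = "\<lambda>j x t. ennreal (indicator (Q (real j)) (x, t) * \<bar>w (x, t)\<bar> powr c)"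
  have Qj: "Q (real i) \<subseteq> Q (real j)" if "i \<le> j" for i j
    using mono that by auto
  have inc: "incseq (\<lambda>j x. ?f j x t)" for t
    using Qj by (auto simp: incseq_def le_fun_def indicator_def intro!: ennreal_leI)
  have sup: "(SUP j. ?f j x t) = ennreal (\<bar>w (x, t)\<bar> powr c)" for x t
  proof (rule antisym)
    show "(SUP j. ?f j x t) \<le> ennreal (\<bar>w (x, t)\<bar> powr c)"
      by (intro SUP_least ennreal_leI) (auto simp: indicator_def)
    obtain R where R: "R \<ge> 0" "(x, t) \<in> Q R" using UN by blast
    obtain j where "R \<le> real j" using real_arch_simple by blast
    then have "(x, t) \<in> Q (real j)" using mono R by blast
    then show "ennreal (\<bar>w (x, t)\<bar> powr c) \<le> (SUP j. ?f j x t)"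
      by (intro SUP_upper2[of j]) auto
  qed
  have slice: "(\<lambda>x. ?f j x t) \<in> borel_measurable lborel" for j t
    by measurable
  have slice_sup: "(SUP j. (\<integral>\<^sup>+x. ?f j x t \<partial>lborel)) = (\<integral>\<^sup>+x. ennreal (\<bar>w (x, t)\<bar> powr c) \<partial>lborel)" for t
    by (subst nn_integral_monotone_convergence_SUP[OF inc slice, symmetric]) (simp add: sup)
  have inc_sq: "incseq (\<lambda>j t. (\<integral>\<^sup>+x. ?f j x t \<partial>lborel)\<^sup>2)"
    using inc by (auto simp: incseq_def le_fun_def intro!: power_mono nn_integral_mono)
  have "(SUP j. (\<integral>\<^sup>+x. ?f j x t \<partial>lborel)\<^sup>2) = (\<integral>\<^sup>+x. ennreal (\<bar>w (x, t)\<bar> powr c) \<partial>lborel)\<^sup>2" for t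
  proof -
    have i: "incseq (\<lambda>j. \<integral>\<^sup>+x. ?f j x t \<partial>lborel)"
      using inc by (auto simp: incseq_def le_fun_def intro!: nn_integral_mono)
    \<comment> \<open>Multiplication on \<open>ennreal\<close> is discontinuous only at 0 times
      \<infinity>, which cannot occur for a square.\<close>
    have "(\<lambda>j. (\<integral>\<^sup>+x. ?f j x t \<partial>lborel)\<^sup>2) \<longlonglongrightarrow> (\<integral>\<^sup>+x. ennreal (\<bar>w (x, t)\<bar> powr c) \<partial>lborel)\<^sup>2"
      unfolding power2_eq_square using LIMSEQ_SUP[OF i] unfolding slice_sup
      by (intro tendsto_mult_ennreal) auto
    moreover have "incseq (\<lambda>j. (\<integral>\<^sup>+x. ?f j x t \<partial>lborel)\<^sup>2)"
      using inc_sq by (simp add: incseq_def le_fun_def)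
    ultimately show ?thesis using LIMSEQ_SUP LIMSEQ_unique by blast
  qed
  then have "energy c w (\<lambda>z. 1) = (\<integral>\<^sup>+t. (SUP j. (\<integral>\<^sup>+x. ?f j x t \<partial>lborel)\<^sup>2) \<partial>lborel)"
    by (simp add: energy_def)
  also have "\<dots> = (SUP j. energy c w (indicator (Q (real j))))"
    unfolding energy_def by (rule nn_integral_monotone_convergence_SUP[OF inc_sq]) measurable
  finally obtain j where j: "a < energy c w (indicator (Q (real j)))"
    using a by (auto simp: less_SUP_iff)
  show "\<forall>\<^sub>F R in at_top. a < energy c w (indicator (Q R))"
    using eventually_ge_at_top[of "real j"]
  proof eventually_elim
    case (elim R)
    then have "energy c w (indicator (Q (real j))) \<le> energy c w (indicator (Q R))"
      using mono[of "real j" R] by (intro energy_mono) (auto simp: indicator_def)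
    then show ?case using j by order
  qed
next
  fix a assume "energy c w (\<lambda>z. 1) < a"
  then show "\<forall>\<^sub>F R in at_top. energy c w (indicator (Q R)) < a"
    using energy_mono[of "indicator (Q _)" "\<lambda>z. 1" c w] by (auto simp: indicator_def intro!: always_eventually elim!: le_less_trans[rotated])
qed

subsection \<open>The two basic estimates\<close>

text \<open>Two points of \<open>ball 0 \<rho>\<close> are less than 2\<rho> apart, so the kernel is
  at least \<kappa> between them. The point y = \<open>fst z\<close>, where the value
  \<open>K 0\<close> is unconstrained, is removed as a null set.\<close>

lemma conv_lower_bound:
  fixes w w' :: "'a::euclidean_space \<times> real \<Rightarrow> real"
  assumes "\<And>r. r > 0 \<Longrightarrow> K r > 0" and \<kappa>: "0 \<le> \<kappa>" "\<And>r. 0 < r \<Longrightarrow> r < 2 * \<rho> \<Longrightarrow> \<kappa> \<le> K r"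
    and "conv_finite K p w"
    and w': "w' \<in> borel_measurable borel" "AE z in lborel. z \<in> upper_half \<longrightarrow> w z = w' z"
  shows "AE z in lborel. z \<in> upper_half \<longrightarrow> fst z \<in> ball 0 \<rho> \<longrightarrow>
    ennreal \<kappa> * (\<integral>\<^sup>+y. ennreal (indicator (ball 0 \<rho>) y * \<bar>w' (y, snd z)\<bar> powr p) \<partial>lborel)
      \<le> ennreal (conv K p w z)"
proof -
  have "AE z in lborel. z \<in> upper_half \<longrightarrow> integrable lebesgue (conv_integrand K p w z)"
    using assms(4) by (simp add: conv_finite_def AE_completion_iff)
  \<comment> \<open>The convolution at z reads w on the entire slice of time \<open>snd z\<close>,
    so equality almost everywhere in space-time is first turned into equality almost everywhere on
    almost every slice.\<close>
  moreover have "AE z in (lborel :: ('a \<times> real) measure).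
      AE y in lborel. (y, snd z) \<in> upper_half \<longrightarrow> w (y, snd z) = w' (y, snd z)"
    by (rule AE_time_lift[OF AE_time_slices[OF w'(2)]])
  ultimately show ?thesis
  proof eventually_elim
    case (elim z)
    show ?case
    proof (intro impI)
      assume z: "z \<in> upper_half" "fst z \<in> ball 0 \<rho>"
      then have int: "integrable lebesgue (conv_integrand K p w z)" using elim(1) by blast
      have up: "(y, snd z) \<in> upper_half" for y :: 'a
        using z(1) by (auto simp: upper_half_def)
      have nn: "AE y in lborel. 0 \<le> conv_integrand K p w z y"
        using AE_lborel_singleton[of "fst z"]
        by eventually_elim (use assms(1) in \<open>simp add: conv_integrand_def less_imp_le\<close>)
      have [measurable]: "w' \<in> borel_measurable borel" by fact
      have [measurable]: "ball 0 \<rho> \<in> sets (borel :: 'a measure)" by simp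
      have [measurable]: "(\<lambda>y. w' (y, snd z)) \<in> borel_measurable borel"
        by (rule borel_measurable_slice[OF w'(1)])
      have "ennreal \<kappa> * (\<integral>\<^sup>+y. ennreal (indicator (ball 0 \<rho>) y * \<bar>w' (y, snd z)\<bar> powr p) \<partial>lborel)
        = (\<integral>\<^sup>+y. ennreal \<kappa> * ennreal (indicator (ball 0 \<rho>) y * \<bar>w' (y, snd z)\<bar> powr p) \<partial>lborel)"
        by (rule nn_integral_cmult[symmetric]) measurable
      also have "\<dots> \<le> (\<integral>\<^sup>+y. ennreal (conv_integrand K p w z y) \<partial>lborel)"
      proof (rule nn_integral_mono_AE)
        show "AE y in lborel. ennreal \<kappa> * ennreal (indicator (ball 0 \<rho>) y * \<bar>w' (y, snd z)\<bar> powr p)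
            \<le> ennreal (conv_integrand K p w z y)"
          using nn elim(2) AE_lborel_singleton[of "fst z"]
        proof eventually_elim
          case (elim y)
          show ?case
          proof (cases "y \<in> ball 0 \<rho>")
            case True
            then have "norm (fst z - y) < 2 * \<rho>"
              using z(2) norm_triangle_ineq4[of "fst z" y] by simp
            then have "\<kappa> \<le> K (norm (fst z - y))"
              using elim(3) by (intro \<kappa>(2)) auto
            then show ?thesis
              using True elim(2) up \<kappa>(1) unfolding conv_integrand_def
              by (simp add: ennreal_mult[symmetric] ennreal_leI mult_right_mono)
          qed simp
        qed
      qed
      also have "\<dots> = (\<integral>\<^sup>+y. ennreal (conv_integrand K p w z y) \<partial>lebesgue)"
        by (simp add: nn_integral_completion)
      also have "\<dots> = ennreal (conv K p w z)"
        unfolding conv_def using nn by (intro nn_integral_eq_integral int) (simp add: AE_completion_iff)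
      finally show "ennreal \<kappa> * (\<integral>\<^sup>+y. ennreal (indicator (ball 0 \<rho>) y * \<bar>w' (y, snd z)\<bar> powr p) \<partial>lborel)
          \<le> ennreal (conv K p w z)" .
    qed
  qed
qed

lemma conv_nonneg:
  assumes "\<And>r. r > 0 \<Longrightarrow> K r > 0"
  shows "0 \<le> conv K p w z"
  unfolding conv_def
proof (rule integral_nonneg_AE)
  have "AE y in lborel. 0 \<le> conv_integrand K p w z y"
    using AE_lborel_singleton[of "fst z"]
    by eventually_elim (use assms in \<open>simp add: conv_integrand_def less_imp_le\<close>)
  then show "AE y in lebesgue. 0 \<le> conv_integrand K p w z y"
    by (simp add: AE_completion_iff)
qed

text \<open>On \<open>ball 0 \<rho>\<close> the kernel is at least \<open>\<kappa>\<close>, so the double integral dominates a product of two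
  slice integrals, and the Cauchy-Schwarz inequality merges the exponents \<open>p\<close> and \<open>q\<close>.\<close>

lemma energy_le_integral:
  fixes w w' :: "'a::euclidean_space \<times> real \<Rightarrow> real"
  assumes K: "\<And>r. r > 0 \<Longrightarrow> K r > 0" and \<kappa>: "0 \<le> \<kappa>" "\<And>r. 0 < r \<Longrightarrow> r < 2 * \<rho> \<Longrightarrow> \<kappa> \<le> K r"
    and fin: "conv_finite K p w"
    and w': "w' \<in> borel_measurable borel" "\<And>z. z \<notin> upper_half \<Longrightarrow> w' z = 0"
      "AE z in lborel. z \<in> upper_half \<longrightarrow> w z = w' z"
    and \<phi>: "\<phi> \<in> borel_measurable borel" "\<And>z. 0 \<le> \<phi> z" "\<And>z. \<phi> z \<le> 1"
      "\<And>z. \<phi> z \<noteq> 0 \<Longrightarrow> fst z \<in> ball 0 \<rho>"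
    and int: "set_integrable lebesgue upper_half (\<lambda>z. conv K p w z * \<bar>w z\<bar> powr q * \<phi> z)"
  shows "ennreal \<kappa> * energy ((p + q) / 2) w' \<phi>
      \<le> ennreal (LINT z:upper_half|lebesgue. conv K p w z * \<bar>w z\<bar> powr q * \<phi> z)"
proof -
  have [measurable]: "w' \<in> borel_measurable borel" "\<phi> \<in> borel_measurable borel" by fact+
  define h where "h t = (\<integral>\<^sup>+y. ennreal (indicator (ball 0 \<rho>) y * \<bar>w' (y, t)\<bar> powr p) \<partial>lborel)" for t
  have [measurable]: "h \<in> borel_measurable borel"
  proof -
    have [measurable]: "fst \<in> borel_measurable (borel :: ('a \<times> real) measure)"
      by (intro borel_measurable_continuous_onI continuous_intros)
    have [measurable]: "ball 0 \<rho> \<in> sets (borel :: 'a measure)" by simp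
    have "(\<lambda>z. ennreal (indicator (ball 0 \<rho>) (fst z) * \<bar>w' z\<bar> powr p)) \<in> borel_measurable borel"
      by measurable
    from borel_measurable_time_slice[OF this] show ?thesis by (simp add: h_def[abs_def])
  qed
  have slice: "(\<integral>\<^sup>+x. ennreal (\<phi> (x, t) * \<bar>w' (x, t)\<bar> powr ((p + q) / 2)) \<partial>lborel)\<^sup>2
      \<le> h t * (\<integral>\<^sup>+x. ennreal (\<bar>w' (x, t)\<bar> powr q * \<phi> (x, t)) \<partial>lborel)" for t
  proof -
    \<comment> \<open>The test function goes wholly into the second factor: its support supplies the
      indicator in the first one, and after squaring \<phi>^2 \<le> \<phi>.\<close>
    let ?f = "\<lambda>x. ennreal (indicator (ball 0 \<rho>) x * \<bar>w' (x, t)\<bar> powr (p / 2))"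
    let ?g = "\<lambda>x. ennreal (\<bar>w' (x, t)\<bar> powr (q / 2) * \<phi> (x, t))"
    have [measurable]: "(\<lambda>x. w' (x, t)) \<in> borel_measurable borel" "(\<lambda>x. \<phi> (x, t)) \<in> borel_measurable borel"
      "ball 0 \<rho> \<in> sets (borel :: 'a measure)"
      using borel_measurable_slice w'(1) \<phi>(1) by auto
    have sq: "(r powr (c / 2))\<^sup>2 = r powr c" if "r \<ge> 0" for r c :: real
      using that by (simp add: power2_eq_square flip: powr_add)
    have eq: "(\<integral>\<^sup>+x. ennreal (\<phi> (x, t) * \<bar>w' (x, t)\<bar> powr ((p + q) / 2)) \<partial>lborel)
        = (\<integral>\<^sup>+x. ?f x * ?g x \<partial>lborel)"
    proof (rule nn_integral_cong)
      fix x
      show "ennreal (\<phi> (x, t) * \<bar>w' (x, t)\<bar> powr ((p + q) / 2)) = ?f x * ?g x"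
      proof (cases "\<phi> (x, t) = 0")
        case False
        then have "x \<in> ball 0 \<rho>" using \<phi>(4) by fastforce
        then show ?thesis using \<phi>(2)[of "(x, t)"]
          by (simp add: add_divide_distrib powr_add ennreal_mult[symmetric] ac_simps)
      qed simp
    qed
    have "(\<integral>\<^sup>+x. ennreal (\<phi> (x, t) * \<bar>w' (x, t)\<bar> powr ((p + q) / 2)) \<partial>lborel)\<^sup>2 \<le> (\<integral>\<^sup>+x. (?f x)\<^sup>2 \<partial>lborel) * (\<integral>\<^sup>+x. (?g x)\<^sup>2 \<partial>lborel)"
      unfolding eq by (rule Cauchy_Schwarz_nn_integral) measurable
    also have "(\<integral>\<^sup>+x. (?f x)\<^sup>2 \<partial>lborel) = h t"
      unfolding h_def by (intro nn_integral_cong) (simp add: ennreal_power power_mult_distrib sq indicator_def)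
    also have "(\<integral>\<^sup>+x. (?g x)\<^sup>2 \<partial>lborel) \<le> (\<integral>\<^sup>+x. ennreal (\<bar>w' (x, t)\<bar> powr q * \<phi> (x, t)) \<partial>lborel)"
    proof (rule nn_integral_mono)
      fix x
      have "(\<phi> (x, t))\<^sup>2 \<le> \<phi> (x, t)"
        using \<phi>(2,3)[of "(x, t)"] by (simp add: power2_eq_square mult_left_le)
      then show "(?g x)\<^sup>2 \<le> ennreal (\<bar>w' (x, t)\<bar> powr q * \<phi> (x, t))"
        using \<phi>(2)[of "(x, t)"]
        by (simp add: ennreal_power power_mult_distrib sq ennreal_leI mult_left_mono)
    qed
    finally show ?thesis by (simp add: mult_left_mono)
  qed
  have [measurable]: "(\<lambda>z :: 'a \<times> real. h (snd z)) \<in> borel_measurable borel"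
    by (rule measurable_compose[of snd _ borel])
      (simp_all add: borel_measurable_continuous_onI continuous_on_snd)
  have "ennreal \<kappa> * energy ((p + q) / 2) w' \<phi>
      \<le> ennreal \<kappa> * (\<integral>\<^sup>+t. h t * (\<integral>\<^sup>+x. ennreal (\<bar>w' (x, t)\<bar> powr q * \<phi> (x, t)) \<partial>lborel) \<partial>lborel)"
    unfolding energy_def by (intro mult_left_mono nn_integral_mono slice) auto
  also have "\<dots> = (\<integral>\<^sup>+t. (\<integral>\<^sup>+x. ennreal \<kappa> * h t * ennreal (\<bar>w' (x, t)\<bar> powr q * \<phi> (x, t)) \<partial>lborel) \<partial>lborel)"
    by (simp add: nn_integral_cmult mult.assoc)
  also have "\<dots> = (\<integral>\<^sup>+z. ennreal \<kappa> * h (snd z) * ennreal (\<bar>w' z\<bar> powr q * \<phi> z) \<partial>lborel)"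
    by (subst nn_integral_time_slices) auto
  also have "\<dots> \<le> (\<integral>\<^sup>+z. ennreal (indicator upper_half z *\<^sub>R (conv K p w z * \<bar>w z\<bar> powr q * \<phi> z)) \<partial>lborel)"
  proof (rule nn_integral_mono_AE)
    have lower: "AE z in lborel. z \<in> upper_half \<longrightarrow> fst z \<in> ball 0 \<rho> \<longrightarrow>
        ennreal \<kappa> * h (snd z) \<le> ennreal (conv K p w z)"
      unfolding h_def by (rule conv_lower_bound) (use K \<kappa> fin w' in auto)
    show "AE z in lborel. ennreal \<kappa> * h (snd z) * ennreal (\<bar>w' z\<bar> powr q * \<phi> z)
        \<le> ennreal (indicator upper_half z *\<^sub>R (conv K p w z * \<bar>w z\<bar> powr q * \<phi> z))"
      using lower w'(3)
    proof eventually_elim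
      case (elim z)
      have "0 \<le> conv K p w z" using K by (rule conv_nonneg)
      show ?case
      proof (cases "z \<in> upper_half \<and> \<phi> z \<noteq> 0")
        case True
        then have "ennreal \<kappa> * h (snd z) \<le> ennreal (conv K p w z)" "w z = w' z"
          using elim \<phi>(4) by auto
        then have "ennreal \<kappa> * h (snd z) * ennreal (\<bar>w' z\<bar> powr q * \<phi> z)
            \<le> ennreal (conv K p w z) * ennreal (\<bar>w' z\<bar> powr q * \<phi> z)"
          by (intro mult_right_mono) auto
        also have "\<dots> = ennreal (indicator upper_half z *\<^sub>R (conv K p w z * \<bar>w z\<bar> powr q * \<phi> z))"
          using True elim(2) \<phi>(2)[of z] \<open>0 \<le> conv K p w z\<close>
          by (simp add: mult.assoc flip: ennreal_mult)
        finally show ?thesis .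
      next
        case False
        then show ?thesis using w'(2)[of z] by auto
      qed
    qed
  qed
  also have "\<dots> = (\<integral>\<^sup>+z. ennreal (indicator upper_half z *\<^sub>R (conv K p w z * \<bar>w z\<bar> powr q * \<phi> z)) \<partial>lebesgue)"
    by (simp add: nn_integral_completion)
  also have "\<dots> = ennreal (LINT z:upper_half|lebesgue. conv K p w z * \<bar>w z\<bar> powr q * \<phi> z)"
    using int conv_nonneg[of K p w] K \<phi>(2) unfolding set_lebesgue_integral_def set_integrable_def
    by (intro nn_integral_eq_integral) (auto intro!: AE_I2 mult_nonneg_nonneg)
  finally show ?thesis .
qed

text \<open>This is Hoelder's inequality for f against the indicator of D, obtained by integrating
  Young's inequality pointwise. The Young weight must be positive, hence the separate case A =
  0.\<close>

lemma nn_integral_power_bound: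
  fixes f :: "'a \<Rightarrow> real"
  assumes [measurable]: "f \<in> borel_measurable M" "D \<in> sets M"
    and f: "\<And>x. 0 \<le> f x" "\<And>x. x \<notin> D \<Longrightarrow> f x = 0" and r: "r > 1"
    and A: "(\<integral>\<^sup>+x. ennreal (f x powr r) \<partial>M) \<le> ennreal A" "0 \<le> A"
    and B: "emeasure M D \<le> ennreal B" "0 < B"
  shows "(\<integral>\<^sup>+x. ennreal (f x) \<partial>M) \<le> ennreal (A powr (1 / r) * B powr (1 - 1 / r))"
proof (cases "A = 0")
  case True
  then have "AE x in M. ennreal (f x powr r) = 0"
    using A by (subst nn_integral_0_iff_AE[symmetric]) auto
  then have "AE x in M. ennreal (f x) = 0" by eventually_elim simp
  then have "(\<integral>\<^sup>+x. ennreal (f x) \<partial>M) = 0" by (subst nn_integral_0_iff_AE) auto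
  then show ?thesis by simp
next
  case False
  \<comment> \<open>The optimal weight: the two Young terms A/r and (1 - 1/r) s B then add up to
    exactly A.\<close>
  define s where "s = A / B"
  have s: "s > 0" using False A B by (simp add: s_def)
  define \<beta> where "\<beta> = 1 - 1 / r"
  have \<beta>: "\<beta> \<ge> 0" "1 / r + \<beta> = 1" using r by (auto simp: \<beta>_def)
  have pw: "s powr \<beta> * f x \<le> f x powr r / r + \<beta> * s * indicator D x" for x
  proof (cases "f x = 0")
    case False
    then have x: "x \<in> D" "f x > 0" using f by (auto simp: less_le)
    have "(f x powr r) powr (1 / r) * s powr \<beta> \<le> 1 / r * f x powr r + \<beta> * s"
      using s \<beta> x r by (intro Youngs_inequality_0) auto
    then show ?thesis using x r by (simp add: powr_powr mult.commute)
  qed (use s \<beta> in auto)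
  have "ennreal (s powr \<beta>) * (\<integral>\<^sup>+x. ennreal (f x) \<partial>M) = (\<integral>\<^sup>+x. ennreal (s powr \<beta> * f x) \<partial>M)"
    by (subst nn_integral_cmult[symmetric]) (auto simp: ennreal_mult f)
  also have "\<dots> \<le> (\<integral>\<^sup>+x. ennreal (1 / r) * ennreal (f x powr r) + ennreal (\<beta> * s) * indicator D x \<partial>M)"
  proof (rule nn_integral_mono)
    fix x
    have "ennreal (s powr \<beta> * f x) \<le> ennreal (1 / r * f x powr r + \<beta> * s * indicator D x)"
      using pw[of x] by (intro ennreal_leI) simp
    also have "\<dots> = ennreal (1 / r) * ennreal (f x powr r) + ennreal (\<beta> * s) * indicator D x"
      using r s \<beta> by (simp add: ennreal_plus indicator_def flip: ennreal_mult)
    finally show "ennreal (s powr \<beta> * f x)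
      \<le> ennreal (1 / r) * ennreal (f x powr r) + ennreal (\<beta> * s) * indicator D x" .
  qed
  also have "\<dots> = ennreal (1 / r) * (\<integral>\<^sup>+x. ennreal (f x powr r) \<partial>M) + ennreal (\<beta> * s) * emeasure M D"
    by (simp add: nn_integral_add nn_integral_cmult)
  also have "\<dots> \<le> ennreal (1 / r) * ennreal A + ennreal (\<beta> * s) * ennreal B"
    by (intro add_mono mult_left_mono A B) auto
  also have "\<dots> = ennreal (A / r + \<beta> * s * B)"
    using r A B s \<beta> by (simp flip: ennreal_mult ennreal_plus)
  also have "A / r + \<beta> * s * B = A"
    using B r by (simp add: s_def \<beta>_def field_simps)
  also have "A = s powr \<beta> * (A powr (1 / r) * B powr \<beta>)"
  proof -
    have "s powr \<beta> * B powr \<beta> = A powr \<beta>"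
      using A B by (simp add: s_def flip: powr_mult)
    then have "s powr \<beta> * (A powr (1 / r) * B powr \<beta>) = A powr (1 / r + \<beta>)"
      by (simp add: powr_add ac_simps)
    then show ?thesis using \<beta> A by simp
  qed
  finally have "ennreal (s powr \<beta>) * (\<integral>\<^sup>+x. ennreal (f x) \<partial>M)
      \<le> ennreal (s powr \<beta>) * ennreal (A powr (1 / r) * B powr \<beta>)"
    by (simp add: ennreal_mult)
  then show ?thesis
    using s unfolding \<beta>_def by (subst (asm) ennreal_mult_le_mult_iff) auto
qed

lemma ennreal_power2_le_imp_le:
  fixes x y :: ennreal
  assumes "x\<^sup>2 \<le> y\<^sup>2"
  shows "x \<le> y"
proof (cases x)
  case (real r)
  show ?thesis
  proof (cases y)
    case (real s)
    then have "r\<^sup>2 \<le> s\<^sup>2"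
      using assms \<open>x = ennreal r\<close> \<open>0 \<le> r\<close> by (simp add: ennreal_power ennreal_le_iff)
    then have "r \<le> s"
      using real(1) by (rule power2_le_imp_le)
    then show ?thesis
      using real(2) \<open>x = ennreal r\<close> by (simp add: ennreal_leI)
  qed simp
next
  case top
  then have "y\<^sup>2 = top"
    using assms by (simp add: top_unique top_power_ennreal)
  then show ?thesis by (simp add: power2_eq_square ennreal_mult_eq_top_iff)
qed

text \<open>Dropping the negative part only increases an integral, and a non-integrable function has
  integral 0 by convention.\<close>

lemma ennreal_integral_le_nn_integral:
  fixes f :: "'a \<Rightarrow> real"
  shows "ennreal (integral\<^sup>L M f) \<le> (\<integral>\<^sup>+x. ennreal (f x) \<partial>M)"
proof (cases "integrable M f")
  case True
  have "ennreal (integral\<^sup>L M f) \<le> ennreal (enn2real (\<integral>\<^sup>+x. ennreal (f x) \<partial>M))"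
    unfolding real_lebesgue_integral_def[OF True] by (intro ennreal_leI) simp
  also have "\<dots> \<le> (\<integral>\<^sup>+x. ennreal (f x) \<partial>M)"
    by (cases "\<integral>\<^sup>+x. ennreal (f x) \<partial>M") auto
  finally show ?thesis .
qed (simp add: not_integrable_integral_eq)

text \<open>The integrand is at most C f with f = \<bar>w'\<bar> g^(1/a), and f^a is the density of
  the energy. Cauchy-Schwarz in time bounds the integral of f^a by the root of 2\<tau> times the
  energy; Hoelder on the cylinder takes the power 1/a of that, whence 1/(2a).\<close>

lemma integral_le_energy:
  fixes w w' g :: "'a::euclidean_space \<times> real \<Rightarrow> real"
  assumes w': "w' \<in> borel_measurable borel" "AE z in lborel. z \<in> upper_half \<longrightarrow> w z = w' z"
    and g: "g \<in> borel_measurable borel" "\<And>z. 0 \<le> g z"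
      "\<And>z. g z \<noteq> 0 \<Longrightarrow> fst z \<in> ball 0 \<rho> \<and> \<bar>snd z\<bar> < \<tau>" and \<rho>\<tau>: "0 < \<rho>" "0 < \<tau>"
    and \<Phi>: "\<And>z. \<bar>\<Phi> z\<bar> \<le> C * g z powr (1 / a)" and "0 \<le> C" "a > 1"
    and fin: "energy a w' g < \<infinity>"
  shows "(LINT z:upper_half|lebesgue. w z * \<Phi> z) \<le>
    C * ((2 * \<tau> * enn2real (energy a w' g)) powr (1 / (2 * a)) *
      (unit_ball_vol DIM('a) * \<rho> ^ DIM('a) * (2 * \<tau>)) powr (1 - 1 / a))"
proof -
  have [measurable]: "w' \<in> borel_measurable borel" "g \<in> borel_measurable borel" by fact+
  define e where "e = enn2real (energy a w' g)"
  have e: "energy a w' g = ennreal e" "e \<ge> 0" using fin by (auto simp: e_def)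
  define f where "f z = \<bar>w' z\<bar> * g z powr (1 / a)" for z
  have [measurable]: "f \<in> borel_measurable borel" unfolding f_def[abs_def] by measurable
  define D where "D = (ball 0 \<rho> :: 'a set) \<times> {-\<tau><..<\<tau>}"
  have [measurable]: "D \<in> sets borel" by (simp add: D_def open_Times)
  define U where "U t = (\<integral>\<^sup>+x. ennreal (g (x, t) * \<bar>w' (x, t)\<bar> powr a) \<partial>lborel)" for t
  have [measurable]: "U \<in> borel_measurable borel"
    unfolding U_def[abs_def] by measurable
  have fa: "f z powr a = g z * \<bar>w' z\<bar> powr a" for z
    using g(2)[of z] \<open>a > 1\<close> by (simp add: f_def powr_mult powr_powr mult.commute)
  have "(\<integral>\<^sup>+z. ennreal (f z powr a) \<partial>lborel) = (\<integral>\<^sup>+t. U t \<partial>lborel)"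
    unfolding fa U_def by (subst nn_integral_time_slices) auto
  \<comment> \<open>The time indicator is inserted as the second Cauchy-Schwarz factor; it
    contributes the finite length 2\<tau>.\<close>
  also have "\<dots> = (\<integral>\<^sup>+t. U t * indicator {-\<tau><..<\<tau>} t \<partial>lborel)"
  proof (rule nn_integral_cong)
    fix t :: real
    have "U t = 0" if "t \<notin> {-\<tau><..<\<tau>}"
    proof -
      have "g (x, t) = 0" for x using that g(3)[of "(x, t)"] by fastforce
      then show ?thesis by (simp add: U_def)
    qed
    then show "U t = U t * indicator {-\<tau><..<\<tau>} t" by (auto simp: indicator_def)
  qed
  finally have "(\<integral>\<^sup>+z. ennreal (f z powr a) \<partial>lborel)\<^sup>2
      = (\<integral>\<^sup>+t. U t * indicator {-\<tau><..<\<tau>} t \<partial>lborel)\<^sup>2" by simp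
  also have "\<dots> \<le> (\<integral>\<^sup>+t. (U t)\<^sup>2 \<partial>lborel) * (\<integral>\<^sup>+t. (indicator {-\<tau><..<\<tau>} t)\<^sup>2 \<partial>lborel)"
    by (rule Cauchy_Schwarz_nn_integral) measurable
  also have "(\<integral>\<^sup>+t. (indicator {-\<tau><..<\<tau>} t)\<^sup>2 \<partial>lborel) = (\<integral>\<^sup>+t. indicator {-\<tau><..<\<tau>} t \<partial>lborel)"
    by (intro nn_integral_cong) (auto simp: indicator_def)
  also have "\<dots> = ennreal (2 * \<tau>)" using \<rho>\<tau> by simp
  also have "(\<integral>\<^sup>+t. (U t)\<^sup>2 \<partial>lborel) = ennreal e" using e by (simp add: energy_def U_def)
  also have "ennreal e * ennreal (2 * \<tau>) = (ennreal (sqrt (2 * \<tau> * e)))\<^sup>2"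
    using e \<rho>\<tau> by (simp add: ennreal_power mult.commute flip: ennreal_mult)
  finally have A: "(\<integral>\<^sup>+z. ennreal (f z powr a) \<partial>lborel) \<le> ennreal (sqrt (2 * \<tau> * e))"
    by (rule ennreal_power2_le_imp_le)
  have "emeasure lborel D = emeasure lborel (ball 0 \<rho> :: 'a set) * emeasure lborel {-\<tau><..<\<tau>}"
    unfolding D_def lborel_prod[symmetric] by (rule lborel.emeasure_pair_measure_Times) auto
  also have "\<dots> = ennreal (unit_ball_vol DIM('a) * \<rho> ^ DIM('a) * (2 * \<tau>))"
    using \<rho>\<tau> by (simp add: emeasure_ball flip: ennreal_mult)
  finally have B: "emeasure lborel D = ennreal (unit_ball_vol DIM('a) * \<rho> ^ DIM('a) * (2 * \<tau>))" .
  have "(\<integral>\<^sup>+z. ennreal (f z) \<partial>lborel) \<le> ennreal (sqrt (2 * \<tau> * e) powr (1 / a) *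
      (unit_ball_vol DIM('a) * \<rho> ^ DIM('a) * (2 * \<tau>)) powr (1 - 1 / a))"
  proof (rule nn_integral_power_bound[where D = D])
    show "f z = 0" if "z \<notin> D" for z
      using that g(3)[of z] by (cases z) (auto simp: D_def f_def)
  qed (use A B \<rho>\<tau> \<open>a > 1\<close> e in \<open>auto simp: f_def unit_ball_vol_pos\<close>)
  also have "sqrt (2 * \<tau> * e) powr (1 / a) = (2 * \<tau> * e) powr (1 / (2 * a))"
    using e \<rho>\<tau> by (simp add: powr_powr flip: powr_half_sqrt)
  finally have F: "(\<integral>\<^sup>+z. ennreal (f z) \<partial>lborel) \<le> ennreal ((2 * \<tau> * e) powr (1 / (2 * a)) *
      (unit_ball_vol DIM('a) * \<rho> ^ DIM('a) * (2 * \<tau>)) powr (1 - 1 / a))" (is "_ \<le> ennreal ?B") .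
  have "ennreal (LINT z:upper_half|lebesgue. w z * \<Phi> z)
      \<le> (\<integral>\<^sup>+z. ennreal (indicator upper_half z *\<^sub>R (w z * \<Phi> z)) \<partial>lebesgue)"
    unfolding set_lebesgue_integral_def by (rule ennreal_integral_le_nn_integral)
  also have "\<dots> \<le> (\<integral>\<^sup>+z. ennreal C * ennreal (f z) \<partial>lborel)"
    unfolding nn_integral_completion
  proof (rule nn_integral_mono_AE)
    show "AE z in lborel. ennreal (indicator upper_half z *\<^sub>R (w z * \<Phi> z)) \<le> ennreal C * ennreal (f z)"
      using w'(2)
    proof eventually_elim
      case (elim z)
      have "w' z * \<Phi> z \<le> \<bar>w' z\<bar> * \<bar>\<Phi> z\<bar>"
        by (metis abs_ge_self abs_mult)
      also have "\<dots> \<le> \<bar>w' z\<bar> * (C * g z powr (1 / a))"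
        by (intro mult_left_mono \<Phi>) simp
      finally show ?case
        using elim \<open>0 \<le> C\<close>
        by (auto simp: indicator_def f_def ac_simps simp flip: ennreal_mult intro!: ennreal_leI)
    qed
  qed
  also have "\<dots> = ennreal C * (\<integral>\<^sup>+z. ennreal (f z) \<partial>lborel)"
    by (rule nn_integral_cmult) measurable
  also have "\<dots> \<le> ennreal (C * ?B)"
    using F \<open>0 \<le> C\<close> by (simp add: ennreal_mult mult_left_mono)
  finally show ?thesis using \<open>0 \<le> C\<close> by (simp add: e_def ennreal_le_iff)
qed

subsection \<open>Rescaled test functions in the weak inequality\<close>

text \<open>These are the properties delivered by \<open>test_function\<close>; a single \<phi> is
  fixed for both inequalities of the system.\<close>

locale scaled_test =
  fixes m k :: nat and \<theta> C :: real and \<phi> :: "'a::euclidean_space \<times> real \<Rightarrow> real"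
  assumes m: "m \<ge> 1" and k: "k \<ge> 1" and smooth: "smooth \<phi>"
    and nonneg: "\<And>z. 0 \<le> \<phi> z" and le_1: "\<And>z. \<phi> z \<le> 1" and C: "C > 0"
    and eq_1: "\<And>z. norm (fst z) \<le> 1 \<Longrightarrow> \<bar>snd z\<bar> \<le> 1 \<Longrightarrow> \<phi> z = 1"
    and support: "\<And>z. \<phi> z \<noteq> 0 \<Longrightarrow> norm (fst z) < 2 \<and> \<bar>snd z\<bar> < 2"
    and dt_initial: "\<And>l x. (dt ^^ Suc l) \<phi> (x, 0) = 0"
    and bound: "\<And>z. \<bar>(dt ^^ k) \<phi> z\<bar> + \<bar>polyharmonic m \<phi> z\<bar> \<le> C * \<phi> z powr \<theta>"
    and core: "\<And>z. norm (fst z) < 1 \<Longrightarrow> \<bar>snd z\<bar> < 1 \<Longrightarrow> (dt ^^ k) \<phi> z = 0 \<and> polyharmonic m \<phi> z = 0"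
begin

text \<open>The parabolic scaling makes both \<open>dt ^^ k\<close> and \<open>polyharmonic m\<close> gain the factor
  \<open>R powr (- 2 * m)\<close>.\<close>

definition T :: "real \<Rightarrow> real" where "T R = R powr (2 * m / k)"

definition \<phi>s :: "real \<Rightarrow> 'a \<times> real \<Rightarrow> real" where
  "\<phi>s R z = \<phi> (rescale (1 / R) (1 / T R) z)"

definition Q :: "real \<Rightarrow> ('a \<times> real) set" where
  "Q R = ball 0 R \<times> {- T R<..<T R}"

text \<open>On \<open>Q R\<close> the rescaled test function is 1 and the operators applied to it
  vanish, so the left-hand side is controlled by this remainder alone.\<close>

definition outer :: "real \<Rightarrow> 'a \<times> real \<Rightarrow> real" where
  "outer R z = indicator (- Q R) z * \<phi>s R z"

lemma T_pos: "R > 0 \<Longrightarrow> T R > 0"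
  by (simp add: T_def)

lemma mem_Q:
  assumes "R > 0"
  shows "z \<in> Q R \<longleftrightarrow> norm ((1 / R) *\<^sub>R fst z) < 1 \<and> \<bar>1 / T R * snd z\<bar> < 1"
  using assms T_pos[OF assms] by (cases z) (auto simp: Q_def abs_mult field_simps)

lemma \<phi>s_support:
  assumes "R > 0" "\<phi>s R z \<noteq> 0"
  shows "fst z \<in> ball 0 (2 * R)" "\<bar>snd z\<bar> < 2 * T R"
  using support[of "rescale (1 / R) (1 / T R) z"] assms T_pos[OF assms(1)]
  by (auto simp: \<phi>s_def rescale_def abs_mult field_simps)

lemma \<phi>s_eq_1: "R > 0 \<Longrightarrow> z \<in> Q R \<Longrightarrow> \<phi>s R z = 1"
  unfolding \<phi>s_def by (rule eq_1) (auto simp: mem_Q rescale_def)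

lemma \<phi>s_nonneg: "0 \<le> \<phi>s R z" and \<phi>s_le_1: "\<phi>s R z \<le> 1"
  by (simp_all add: \<phi>s_def nonneg le_1)

lemma smooth_\<phi>s: "smooth (\<phi>s R)"
  using smooth_rescale[OF smooth] by (simp add: \<phi>s_def[abs_def])

lemma \<phi>s_measurable [measurable]: "\<phi>s R \<in> borel_measurable borel"
  using smooth_continuous[OF smooth_\<phi>s] by (rule borel_measurable_continuous_onI)

lemma Q_measurable [measurable]: "Q R \<in> sets borel"
  by (simp add: Q_def open_Times)

lemma outer_measurable [measurable]: "outer R \<in> borel_measurable borel"
  unfolding outer_def[abs_def] by measurable

lemma outer_nonneg: "0 \<le> outer R z" and outer_le: "outer R z \<le> \<phi>s R z"
  by (auto simp: outer_def \<phi>s_nonneg indicator_def)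

lemma core_plus_outer:
  assumes "R > 0"
  shows "indicator (Q R) z + outer R z = \<phi>s R z"
  using \<phi>s_eq_1[OF assms] by (auto simp: outer_def indicator_def)

lemma Cc_infinity_\<phi>s:
  assumes "R > 0"
  shows "\<phi>s R \<in> Cc_infinity"
proof -
  have "{z. \<phi>s R z \<noteq> 0} \<subseteq> ball 0 (2 * R) \<times> {- (2 * T R)..2 * T R}"
    using \<phi>s_support[OF assms] by (force simp: mem_Times_iff)
  then have "bounded {z. \<phi>s R z \<noteq> 0}"
    by (rule bounded_subset[rotated]) (intro bounded_Times bounded_ball bounded_closed_interval)
  then show ?thesis
    using smooth_\<phi>s by (simp add: Cc_infinity_def smooth_def compact_closure)
qed

text \<open>On the core both sides are 0 by local constancy. Elsewhere \<phi> \<le> 1 gives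
  \<phi>^\<theta> \<le> \<phi>^(1/a) whenever 1/a \<le> \<theta>, so that one \<theta> serves two
  different exponents a.\<close>

lemma operator_bound:
  assumes "R > 0" "0 < 1 / a" "1 / a \<le> \<theta>"
  shows "\<bar>(- 1) ^ k * (dt ^^ k) (\<phi>s R) z + polyharmonic m (\<phi>s R) z\<bar>
    \<le> C * R powr (- (2 * m)) * outer R z powr (1 / a)"
proof -
  let ?z = "rescale (1 / R) (1 / T R) z"
  have "T R ^ k = R powr (2 * m)"
    using assms k by (simp add: T_def powr_powr flip: powr_realpow)
  then have Tk: "(1 / T R) ^ k = R powr (- (2 * m))"
    by (simp add: power_one_over powr_minus_divide)
  have Rm: "(1 / R) ^ (2 * m) = R powr (- (2 * m))"
    using assms powr_realpow[of R "2 * m"] by (simp add: power_one_over powr_minus_divide)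
  have "(- 1) ^ k * (dt ^^ k) (\<phi>s R) z + polyharmonic m (\<phi>s R) z
      = R powr (- (2 * m)) * ((- 1) ^ k * (dt ^^ k) \<phi> ?z + polyharmonic m \<phi> ?z)"
    using dt_rescale[OF smooth, of k "1 / R" "1 / T R"] polyharmonic_rescale[OF smooth, of m "1 / R" "1 / T R"]
    unfolding \<phi>s_def[abs_def] Tk Rm by (simp add: algebra_simps)
  then have eq: "\<bar>(- 1) ^ k * (dt ^^ k) (\<phi>s R) z + polyharmonic m (\<phi>s R) z\<bar>
      = R powr (- (2 * m)) * \<bar>(- 1) ^ k * (dt ^^ k) \<phi> ?z + polyharmonic m \<phi> ?z\<bar>"
    by (simp add: abs_mult)
  have "\<bar>(- 1) ^ k * (dt ^^ k) \<phi> ?z + polyharmonic m \<phi> ?z\<bar> \<le> C * outer R z powr (1 / a)"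
  proof (cases "z \<in> Q R")
    case True
    then show ?thesis using core[of ?z] mem_Q[OF assms(1)] C by (simp add: rescale_def)
  next
    case False
    have "\<bar>(- 1) ^ k * (dt ^^ k) \<phi> ?z + polyharmonic m \<phi> ?z\<bar>
        \<le> \<bar>(- 1) ^ k * (dt ^^ k) \<phi> ?z\<bar> + \<bar>polyharmonic m \<phi> ?z\<bar>"
      by (rule abs_triangle_ineq)
    also have "\<dots> \<le> C * \<phi> ?z powr \<theta>"
      using bound[of ?z] by (simp add: abs_mult)
    also have "\<dots> \<le> C * \<phi> ?z powr (1 / a)"
      using C assms nonneg[of ?z] le_1[of ?z] by (intro mult_left_mono powr_mono') auto
    finally show ?thesis using False by (simp add: outer_def \<phi>s_def)
  qed
  then have "R powr (- (2 * m)) * \<bar>(- 1) ^ k * (dt ^^ k) \<phi> ?z + polyharmonic m \<phi> ?z\<bar>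
      \<le> R powr (- (2 * m)) * (C * outer R z powr (1 / a))"
    by (rule mult_left_mono) simp
  then show ?thesis
    unfolding eq by (simp add: ac_simps)
qed

text \<open>Integrable data may change sign; since \<open>\<phi>s R (x, 0)\<close> equals 1 as soon
  as R > \<bar>x\<bar>, dominated convergence gives the limit of the integrals, and its strict
  positivity persists for large R.\<close>

lemma eventually_initial_nonneg:
  assumes "(AE x in lebesgue. 0 \<le> f x) \<or> integrable lebesgue f \<and> (LINT x|lebesgue. f x) > 0"
  shows "\<forall>\<^sub>F R in at_top. 0 \<le> (LINT x|lebesgue. f x * \<phi>s R (x, 0))"
  using assms
proof
  assume "AE x in lebesgue. 0 \<le> f x"
  then have "0 \<le> (LINT x|lebesgue. f x * \<phi>s R (x, 0))" for R
    by (intro integral_nonneg_AE) (auto elim!: eventually_mono simp: \<phi>s_nonneg)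
  then show ?thesis by simp
next
  assume f: "integrable lebesgue f \<and> (LINT x|lebesgue. f x) > 0"
  have "((\<lambda>R. LINT x|lebesgue. f x * \<phi>s R (x, 0)) \<longlongrightarrow> (LINT x|lebesgue. f x)) at_top"
  proof (rule integral_dominated_convergence_at_top[where w = "\<lambda>x. norm (f x)"])
    show "f \<in> borel_measurable lebesgue" using f by auto
    show "(\<lambda>x. f x * \<phi>s R (x, 0)) \<in> borel_measurable lebesgue" for R
    proof -
      have "(\<lambda>x. \<phi>s R (x, 0)) \<in> borel_measurable lebesgue"
        using borel_measurable_slice[OF \<phi>s_measurable] by (intro measurable_completion) simp
      then show ?thesis using f by (intro borel_measurable_times) auto
    qed
    show "integrable lebesgue (\<lambda>x. norm (f x))" using f by auto
    show "\<forall>\<^sub>F R in at_top. AE x in lebesgue. norm (f x * \<phi>s R (x, 0)) \<le> norm (f x)"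
      by (intro always_eventually allI AE_I2) (simp add: abs_mult mult_left_le \<phi>s_nonneg \<phi>s_le_1)
    show "AE x in lebesgue. ((\<lambda>R. f x * \<phi>s R (x, 0)) \<longlongrightarrow> f x) at_top"
    proof (rule AE_I2)
      fix x
      have "\<forall>\<^sub>F R in at_top. f x * \<phi>s R (x, 0) = f x"
        using eventually_gt_at_top[of "norm x"]
      proof eventually_elim
        case (elim R)
        then have "R > 0" by (meson norm_ge_zero order_le_less_trans)
        then show ?case using elim \<phi>s_eq_1[of R "(x, 0)"] T_pos by (simp add: Q_def)
      qed
      then show "((\<lambda>R. f x * \<phi>s R (x, 0)) \<longlongrightarrow> f x) at_top"
        by (rule tendsto_eventually)
    qed
  qed
  then have "\<forall>\<^sub>F R in at_top. 0 < (LINT x|lebesgue. f x * \<phi>s R (x, 0))"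
    using f order_tendstoD(1) by blast
  then show ?thesis by eventually_elim simp
qed

lemma weak_inequality_\<phi>s:
  assumes "weak_inequality k m w0 w F" "R > 0"
    and "0 \<le> (LINT x|lebesgue. w0 (k - 1) x * \<phi>s R (x, 0))"
  shows "set_integrable lebesgue upper_half (\<lambda>z. F z * \<phi>s R z)"
    and "(LINT z:upper_half|lebesgue. F z * \<phi>s R z)
      \<le> (LINT z:upper_half|lebesgue. w z * ((- 1) ^ k * (dt ^^ k) (\<phi>s R) z + polyharmonic m (\<phi>s R) z))"
proof -
  let ?f = "\<lambda>i. (- 1) ^ i * (LINT x|lebesgue. w0 (k - i) x * (dt ^^ (i - 1)) (\<phi>s R) (x, 0))"
  have W: "set_integrable lebesgue upper_half (\<lambda>z. F z * \<phi>s R z)"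
    "(\<Sum>i=1..k. ?f i)
      + (LINT z:upper_half|lebesgue. w z * ((- 1) ^ k * (dt ^^ k) (\<phi>s R) z + polyharmonic m (\<phi>s R) z))
      \<ge> (LINT z:upper_half|lebesgue. F z * \<phi>s R z)"
    using assms(1) Cc_infinity_\<phi>s[OF assms(2)] \<phi>s_nonneg unfolding weak_inequality_def by blast+
  have "?f i = 0" if "i \<in> {1..k} - {1}" for i
  proof -
    have "i - 1 = Suc (i - 2)" using that by auto
    then obtain l where "i - 1 = Suc l" by blast
    moreover have "(dt ^^ Suc l) (\<phi>s R) (x, 0) = 0" for x
      using dt_rescale[OF smooth, of "Suc l" "1 / R" "1 / T R"] dt_initial[of l]
      unfolding \<phi>s_def[abs_def] by (simp add: rescale_def)
    ultimately show ?thesis by simp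
  qed
  then have "(\<Sum>i=1..k. ?f i) = ?f 1"
    using sum.remove[of "{1..k}" 1 ?f] k by simp
  also have "\<dots> \<le> 0" using assms(3) by simp
  finally show "(LINT z:upper_half|lebesgue. F z * \<phi>s R z)
      \<le> (LINT z:upper_half|lebesgue. w z * ((- 1) ^ k * (dt ^^ k) (\<phi>s R) z + polyharmonic m (\<phi>s R) z))"
    using W(2) by linarith
  show "set_integrable lebesgue upper_half (\<lambda>z. F z * \<phi>s R z)" by (rule W(1))
qed

text \<open>In the exponent of R, -2m is the size of the operator and N (1 - 2/c) comes from the
  spatial volume. The time length enters to the power 1/c by Cauchy-Schwarz and 1 - 2/c by Hoelder,
  in total 1 - 1/c. Finiteness of the outer energy stays a premise, since it is the inequality for
  the other unknown that provides it.\<close>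

lemma weak_energy_inequality:
  fixes u v u' v' :: "'a \<times> real \<Rightarrow> real"
  assumes K: "\<And>r. r > 0 \<Longrightarrow> K r > 0" "\<forall>\<^sub>F R in at_top. \<forall>r. 0 < r \<longrightarrow> r < R \<longrightarrow> K R \<le> K r"
    and fin: "conv_finite K p v"
    and weak: "weak_inequality k m w0 u (\<lambda>z. conv K p v z * \<bar>v z\<bar> powr q)"
    and data: "(AE x in lebesgue. 0 \<le> w0 (k - 1) x) \<or>
      integrable lebesgue (w0 (k - 1)) \<and> (LINT x|lebesgue. w0 (k - 1) x) > 0"
    and a: "c > 2" "2 / c \<le> \<theta>"
    and u': "u' \<in> borel_measurable borel" "AE z in lborel. z \<in> upper_half \<longrightarrow> u z = u' z"
    and v': "v' \<in> borel_measurable borel" "\<And>z. z \<notin> upper_half \<Longrightarrow> v' z = 0"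
      "AE z in lborel. z \<in> upper_half \<longrightarrow> v z = v' z"
  shows "\<exists>B>0. \<forall>\<^sub>F R in at_top. energy ((p + q) / 2) v' (\<phi>s R) < \<infinity> \<and>
    (energy (c / 2) u' (outer R) < \<infinity> \<longrightarrow>
      K (4 * R) * enn2real (energy ((p + q) / 2) v' (\<phi>s R)) \<le>
      B * R powr (- (2 * m) + DIM('a) * (1 - 2 / c) + 2 * m / k * (1 - 1 / c)) *
        enn2real (energy (c / 2) u' (outer R)) powr (1 / c))"
proof -
  define \<omega> where "\<omega> = unit_ball_vol (real DIM('a))"
  have \<omega>: "\<omega> > 0" by (simp add: \<omega>_def)
  \<comment> \<open>The numerical factors stem from the support, a cylinder of radius
    \<open>2 * R\<close> and time length \<open>4 * T R\<close>.\<close>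
  define B where "B = C * (4 powr (1 / c) * (\<omega> * 2 ^ DIM('a) * 4) powr (1 - 2 / c))"
  have B: "B > 0" using C \<omega> by (simp add: B_def)
  have "\<forall>\<^sub>F R in at_top. \<forall>r. 0 < r \<longrightarrow> r < 4 * R \<longrightarrow> K (4 * R) \<le> K r"
  proof -
    have "filterlim (\<lambda>R::real. 4 * R) at_top at_top"
      by (rule filterlim_tendsto_pos_mult_at_top[OF tendsto_const _ filterlim_ident]) simp
    then show ?thesis using K(2) by (rule eventually_compose_filterlim[rotated])
  qed
  then have "\<forall>\<^sub>F R in at_top. energy ((p + q) / 2) v' (\<phi>s R) < \<infinity> \<and>
    (energy (c / 2) u' (outer R) < \<infinity> \<longrightarrow>
      K (4 * R) * enn2real (energy ((p + q) / 2) v' (\<phi>s R)) \<le>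
      B * R powr (- (2 * m) + DIM('a) * (1 - 2 / c) + 2 * m / k * (1 - 1 / c)) *
        enn2real (energy (c / 2) u' (outer R)) powr (1 / c))"
    using eventually_initial_nonneg[OF data] eventually_gt_at_top[of 1]
  proof eventually_elim
    case (elim R)
    then have R: "R > 0" and KR: "K (4 * R) > 0" using K(1) by auto
    note weak' = weak_inequality_\<phi>s[OF weak R elim(2)]
    define I where "I = (LINT z:upper_half|lebesgue. conv K p v z * \<bar>v z\<bar> powr q * \<phi>s R z)"
    have lower: "ennreal (K (4 * R)) * energy ((p + q) / 2) v' (\<phi>s R) \<le> ennreal I"
      unfolding I_def
      by (rule energy_le_integral[where \<rho> = "2 * R" and w = v and w' = v'])
        (use K(1) fin v' elim less_imp_le[OF KR] weak'(1) \<phi>s_nonneg \<phi>s_le_1 \<phi>s_support[OF R] in auto)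
    \<comment> \<open>The energy times a positive number is bounded by the real number
      \<open>I\<close>, so it cannot be infinite.\<close>
    have fin_v: "energy ((p + q) / 2) v' (\<phi>s R) < \<infinity>"
      using lower KR by (auto simp: ennreal_mult_top less_top[symmetric] top_unique)
    moreover have "K (4 * R) * enn2real (energy ((p + q) / 2) v' (\<phi>s R)) \<le>
      B * R powr (- (2 * m) + DIM('a) * (1 - 2 / c) + 2 * m / k * (1 - 1 / c)) *
        enn2real (energy (c / 2) u' (outer R)) powr (1 / c)"
      if fin_u: "energy (c / 2) u' (outer R) < \<infinity>"
    proof -
      define e where "e = enn2real (energy (c / 2) u' (outer R))"
      have e: "e \<ge> 0" by (simp add: e_def)
      have "I \<le> C * R powr (- (2 * m)) * ((2 * (2 * T R) * e) powr (1 / (2 * (c / 2))) *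
          (\<omega> * (2 * R) ^ DIM('a) * (2 * (2 * T R))) powr (1 - 1 / (c / 2)))"
        unfolding I_def e_def \<omega>_def
      proof (rule order_trans[OF weak'(2) integral_le_energy[where g = "outer R", OF u']])
        show "fst z \<in> ball 0 (2 * R) \<and> \<bar>snd z\<bar> < 2 * T R" if "outer R z \<noteq> 0" for z
          using that \<phi>s_support[OF R, of z] by (auto simp: outer_def)
        show "\<bar>(- 1) ^ k * (dt ^^ k) (\<phi>s R) z + polyharmonic m (\<phi>s R) z\<bar>
            \<le> C * R powr (- (2 * m)) * outer R z powr (1 / (c / 2))" for z
          using a by (intro operator_bound R) auto
      qed (use R T_pos C a fin_u in \<open>auto simp: outer_nonneg\<close>)
      also have "(2 * (2 * T R) * e) powr (1 / (2 * (c / 2))) = 4 powr (1 / c) * T R powr (1 / c) * e powr (1 / c)"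
        using T_pos[OF R] e by (simp add: powr_mult)
      also have "(\<omega> * (2 * R) ^ DIM('a) * (2 * (2 * T R))) powr (1 - 1 / (c / 2))
          = (\<omega> * 2 ^ DIM('a) * 4) powr (1 - 2 / c) * (R powr (DIM('a) * (1 - 2 / c)) * T R powr (1 - 2 / c))"
      proof -
        have "\<omega> * (2 * R) ^ DIM('a) * (2 * (2 * T R)) = (\<omega> * 2 ^ DIM('a) * 4) * (R powr DIM('a) * T R)"
          using R by (simp add: power_mult_distrib powr_realpow)
        then show ?thesis
          using R T_pos[OF R] \<omega> by (simp add: powr_mult powr_powr)
      qed
      also have "C * R powr (- (2 * m)) * (4 powr (1 / c) * T R powr (1 / c) * e powr (1 / c) *
          ((\<omega> * 2 ^ DIM('a) * 4) powr (1 - 2 / c) * (R powr (DIM('a) * (1 - 2 / c)) * T R powr (1 - 2 / c))))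
        = B * (R powr (- (2 * m)) * R powr (DIM('a) * (1 - 2 / c)) * (T R powr (1 / c) * T R powr (1 - 2 / c)))
          * e powr (1 / c)"
        by (simp add: B_def)
      also have "T R powr (1 / c) * T R powr (1 - 2 / c) = R powr (2 * m / k * (1 - 1 / c))"
      proof -
        have "2 * real m / real k * (1 / c) + 2 * real m / real k * (1 - 2 / c)
            = 2 * real m / real k * (1 / c + (1 - 2 / c))"
          by (rule distrib_left[symmetric])
        then have "2 * real m / real k * (1 / c) + 2 * real m / real k * (1 - 2 / c)
            = 2 * real m / real k * (1 - 1 / c)"
          using a by simp
        then show ?thesis by (simp add: T_def powr_powr flip: powr_add)
      qed
      also have "R powr (- (2 * m)) * R powr (DIM('a) * (1 - 2 / c)) * R powr (2 * m / k * (1 - 1 / c))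
          = R powr (- (2 * m) + DIM('a) * (1 - 2 / c) + 2 * m / k * (1 - 1 / c))"
        by (simp flip: powr_add)
      finally have upper: "I \<le> B * R powr (- (2 * m) + DIM('a) * (1 - 2 / c) + 2 * m / k * (1 - 1 / c)) * e powr (1 / c)" .
      have "ennreal (K (4 * R) * enn2real (energy ((p + q) / 2) v' (\<phi>s R))) \<le> ennreal I"
        using lower fin_v KR by (simp add: ennreal_mult less_imp_le)
      moreover have "0 \<le> conv K p v z * \<bar>v z\<bar> powr q * \<phi>s R z" for z
        using K(1) by (intro mult_nonneg_nonneg conv_nonneg \<phi>s_nonneg) auto
      then have "0 \<le> I"
        unfolding I_def set_lebesgue_integral_def by (intro integral_nonneg_AE AE_I2) simp
      ultimately show ?thesis
        using upper by (simp add: e_def ennreal_le_iff)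
    qed
    ultimately show ?case by blast
  qed
  then show ?thesis using B by blast
qed

end

text \<open>Here A is the energy of the core, P' that of the outer region, P that of the test
  function and Y the total. As P' \<le> P and \<theta> < 1, the frequent bound limits P and hence Y.
  For finite Y, P' \<le> Y - A is eventually small; then P \<le> B P'^\<theta> is frequently small
  although P \<ge> A and A tends to Y.\<close>

lemma energy_limit_eq_0:
  fixes A P P' :: "real \<Rightarrow> ennreal"
  assumes lim: "(A \<longlongrightarrow> Y) at_top"
    and ev: "\<forall>\<^sub>F R in at_top. P R < \<infinity> \<and> A R + P' R \<le> P R \<and> P R \<le> Y"
    and fr: "\<exists>\<^sub>F R in at_top. enn2real (P R) \<le> B * enn2real (P' R) powr \<theta>"
    and "B > 0" "0 < \<theta>" "\<theta> < 1"
  shows "Y = 0"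
proof -
  \<comment> \<open>The frequent bound and any eventual properties hold together at some R.\<close>
  have fr': "\<exists>R. \<Phi> R \<and> P R < \<infinity> \<and> A R + P' R \<le> P R \<and> P R \<le> Y \<and>
      enn2real (P R) \<le> B * enn2real (P' R) powr \<theta>" if "\<forall>\<^sub>F R in at_top. \<Phi> R" for \<Phi>
    using frequently_ex[OF frequently_rev_mp[OF fr eventually_mono[OF eventually_conj[OF ev that]],
      of "\<lambda>R. \<Phi> R \<and> P R < \<infinity> \<and> A R + P' R \<le> P R \<and> P R \<le> Y \<and>
      enn2real (P R) \<le> B * enn2real (P' R) powr \<theta>"]] by auto
  \<comment> \<open>The positive solution of x = B x^\<theta>; above it x > B x^\<theta>.\<close>
  define b where "b = B powr (1 / (1 - \<theta>))"
  have Yb: "Y \<le> ennreal b"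
  proof (rule ccontr)
    assume "\<not> Y \<le> ennreal b"
    then have "\<forall>\<^sub>F R in at_top. ennreal b < A R"
      using lim by (intro order_tendstoD(1)) auto
    from fr'[OF this] obtain R where R: "ennreal b < A R" "P R < \<infinity>" "A R + P' R \<le> P R"
      "enn2real (P R) \<le> B * enn2real (P' R) powr \<theta>" by blast
    define x where "x = enn2real (P R)"
    have x: "P R = ennreal x" "x \<ge> 0" using R(2) by (auto simp: x_def)
    have "A R \<le> P R" "P' R \<le> P R"
      using R(3) order_trans[of "A R" "A R + P' R" "P R"] order_trans[of "P' R" "A R + P' R" "P R"]
      by simp_all
    then have "ennreal b < ennreal x" "P' R \<le> ennreal x"
      using R(1) x(1) by simp_all
    then have bx: "b < x" and P': "enn2real (P' R) \<le> x"
      using x(2) enn2real_leI by (auto simp: ennreal_less_iff b_def)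
    have "B * enn2real (P' R) powr \<theta> \<le> B * x powr \<theta>"
      using P' \<open>B > 0\<close> \<open>0 < \<theta>\<close> by (intro mult_left_mono powr_mono2) auto
    then have xB: "x \<le> B * x powr \<theta>"
      using R(4) unfolding x_def[symmetric] by linarith
    have "x > 0" using bx by (simp add: b_def order_le_less_trans[OF powr_ge_zero])
    then have "x powr (1 - \<theta>) * x powr \<theta> \<le> B * x powr \<theta>"
      using xB by (simp flip: powr_add)
    then have "x powr (1 - \<theta>) \<le> B" using \<open>x > 0\<close> by simp
    moreover have "b powr (1 - \<theta>) < x powr (1 - \<theta>)"
      using bx \<open>\<theta> < 1\<close> by (intro powr_less_mono2) (auto simp: b_def)
    moreover have "b powr (1 - \<theta>) = B"
      using \<open>\<theta> < 1\<close> \<open>B > 0\<close> by (simp add: b_def powr_powr)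
    ultimately show False by simp
  qed
  define y where "y = enn2real Y"
  have y: "Y = ennreal y" "y \<ge> 0"
    using order_le_less_trans[OF Yb ennreal_less_top] by (auto simp: y_def)
  have "y = 0"
  proof (rule ccontr)
    assume "y \<noteq> 0"
    then have "y > 0" using y by simp
    \<comment> \<open>Chosen so that B \<delta>^\<theta> \<le> y/2 \<le> y - \<delta>: the core
      energy would exceed y - \<delta>, while the whole energy would be at most B
      \<delta>^\<theta>.\<close>
    define \<delta> where "\<delta> = min (y / 2) ((y / (2 * B)) powr (1 / \<theta>))"
    have \<delta>: "\<delta> > 0" "\<delta> \<le> y / 2" using \<open>y > 0\<close> \<open>B > 0\<close> by (auto simp: \<delta>_def)
    have "\<delta> powr \<theta> \<le> ((y / (2 * B)) powr (1 / \<theta>)) powr \<theta>"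
      using \<delta>(1) \<open>0 < \<theta>\<close> by (intro powr_mono2) (auto simp: \<delta>_def)
    then have B\<delta>: "B * \<delta> powr \<theta> \<le> y / 2"
      using \<open>y > 0\<close> \<open>B > 0\<close> \<open>0 < \<theta>\<close> by (simp add: powr_powr field_simps)
    have "\<forall>\<^sub>F R in at_top. ennreal (y - \<delta>) < A R"
      using \<delta> y by (intro order_tendstoD(1)[OF lim]) (auto simp: ennreal_less_iff)
    from fr'[OF this] obtain R where R: "ennreal (y - \<delta>) < A R" "A R + P' R \<le> P R" "P R \<le> ennreal y"
      "enn2real (P R) \<le> B * enn2real (P' R) powr \<theta>" using y by auto
    have le: "A R + P' R \<le> ennreal y" using R by order
    then have "A R < top" "P' R < top"
      using ennreal_less_top[of y] by (auto simp: top_unique less_top[symmetric])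
    then obtain \<alpha> \<beta> where \<alpha>\<beta>: "A R = ennreal \<alpha>" "\<alpha> \<ge> 0" "P' R = ennreal \<beta>" "\<beta> \<ge> 0"
      by (metis ennreal_enn2real enn2real_nonneg)
    have "\<alpha> > y - \<delta>" using R(1) \<alpha>\<beta> \<delta> \<open>y > 0\<close> by (simp add: ennreal_less_iff)
    have "\<alpha> + \<beta> \<le> y" using le \<alpha>\<beta> y by (simp flip: ennreal_plus)
    then have "\<beta> \<le> \<delta>" using \<open>\<alpha> > y - \<delta>\<close> by simp
    then have "B * \<beta> powr \<theta> \<le> B * \<delta> powr \<theta>"
      using \<alpha>\<beta> \<open>B > 0\<close> \<open>0 < \<theta>\<close> by (intro mult_left_mono powr_mono2) auto
    moreover have "\<alpha> \<le> enn2real (P R)"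
    proof -
      have "ennreal \<alpha> \<le> P R" using R(2) \<alpha>\<beta> by (metis le_iff_add order_trans)
      moreover have "P R < top" using R(3) ennreal_less_top by (metis order_le_less_trans)
      ultimately show ?thesis using \<alpha>\<beta>(2) enn2real_mono[of "ennreal \<alpha>" "P R"] by simp
    qed
    ultimately show False
      using R(4) B\<delta> \<open>\<alpha> > y - \<delta>\<close> \<delta> \<alpha>\<beta> by simp
  qed
  then show ?thesis using y by simp
qed

text \<open>With \<sigma> = n + s and \<pi> = p + q, the right side is minus the power of R that
  remains when the bound for u, raised to 1/\<sigma>, is inserted into the bound for v.\<close>

lemma critical_exponent:
  fixes N M \<kappa> \<sigma> \<pi> :: real
  shows "(2 * N + 2 * M / \<kappa>) / (\<sigma> * \<pi>) + (N + 2 * M) / \<sigma> - N + 2 * M * (1 - 1 / \<kappa>)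
    = - (- (2 * M) + N * (1 - 2 / \<sigma>) + 2 * M / \<kappa> * (1 - 1 / \<sigma>)
        + (- (2 * M) + N * (1 - 2 / \<pi>) + 2 * M / \<kappa> * (1 - 1 / \<pi>)) / \<sigma>)"
  by (simp add: divide_inverse algebra_simps)

text \<open>The second bound is raised to the power 1/\<sigma> and inserted into the first. The
  powers of R then cancel against the lower bound \<open>c\<close>, which is taken at 4R and
  therefore leaves the constant \<open>4 powr X\<close>.\<close>

lemma combine_energy_bounds:
  fixes K L :: real
  assumes pos: "K > 0" "L > 0" "B1 > 0" "B2 > 0" "R > 0" "c > 0" "\<sigma> > 0"
    and nn: "P \<ge> 0" "P' \<ge> 0" "0 \<le> J'" "J' \<le> J"
    and P: "K * P \<le> B1 * R powr A1 * J' powr (1 / \<sigma>)"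
    and J: "L * J \<le> B2 * R powr A2 * P' powr (1 / \<pi>)"
    and X: "c < K * L powr (1 / \<sigma>) * (4 * R) powr X" "X = - (A1 + A2 / \<sigma>)"
  shows "P \<le> B1 * B2 powr (1 / \<sigma>) * 4 powr X / c * P' powr (1 / (\<pi> * \<sigma>))"
proof -
  have "L powr (1 / \<sigma>) * J' powr (1 / \<sigma>) = (L * J') powr (1 / \<sigma>)"
    using pos nn by (simp add: powr_mult)
  also have "\<dots> \<le> (B2 * R powr A2 * P' powr (1 / \<pi>)) powr (1 / \<sigma>)"
    using pos nn order_trans[OF mult_left_mono[OF nn(4), of L] J] by (intro powr_mono2) auto
  also have "\<dots> = B2 powr (1 / \<sigma>) * R powr (A2 / \<sigma>) * P' powr (1 / (\<pi> * \<sigma>))"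
    using pos nn by (simp add: powr_mult powr_powr)
  finally have J': "L powr (1 / \<sigma>) * J' powr (1 / \<sigma>) \<le> B2 powr (1 / \<sigma>) * R powr (A2 / \<sigma>) * P' powr (1 / (\<pi> * \<sigma>))" .
  have "K * L powr (1 / \<sigma>) * P \<le> B1 * R powr A1 * (L powr (1 / \<sigma>) * J' powr (1 / \<sigma>))"
    using mult_left_mono[OF P, of "L powr (1 / \<sigma>)"] by (simp add: ac_simps)
  also have "\<dots> \<le> B1 * R powr A1 * (B2 powr (1 / \<sigma>) * R powr (A2 / \<sigma>) * P' powr (1 / (\<pi> * \<sigma>)))"
    using pos by (intro mult_left_mono J') auto
  also have "\<dots> = B1 * B2 powr (1 / \<sigma>) * R powr (- X) * P' powr (1 / (\<pi> * \<sigma>))"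
    using X(2) by (simp add: powr_add)
  finally have *: "K * L powr (1 / \<sigma>) * P \<le> B1 * B2 powr (1 / \<sigma>) * R powr (- X) * P' powr (1 / (\<pi> * \<sigma>))" .
  have "c * P \<le> K * L powr (1 / \<sigma>) * (4 * R) powr X * P"
    using X(1) nn by (intro mult_right_mono) auto
  also have "\<dots> = 4 powr X * R powr X * (K * L powr (1 / \<sigma>) * P)"
    using pos by (simp add: powr_mult)
  also have "\<dots> \<le> 4 powr X * R powr X * (B1 * B2 powr (1 / \<sigma>) * R powr (- X) * P' powr (1 / (\<pi> * \<sigma>)))"
    by (intro mult_left_mono *) auto
  also have "\<dots> = B1 * B2 powr (1 / \<sigma>) * 4 powr X * P' powr (1 / (\<pi> * \<sigma>))"
    using pos by (simp add: powr_minus)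
  finally show ?thesis using pos by (simp add: field_simps)
qed

text \<open>The kernels are bounded below by their values at 4R, so the upper limit has to be read
  along 4R; the substitution of R/4 for R achieves this.\<close>

lemma frequently_gt_of_Limsup_pos:
  fixes f :: "real \<Rightarrow> real"
  assumes "Limsup at_top (\<lambda>R. ereal (f R)) > 0"
  shows "\<exists>c>0. \<exists>\<^sub>F R in at_top. c < f (4 * R)"
proof -
  obtain c where c: "0 < ereal c" "ereal c < Limsup at_top (\<lambda>R. ereal (f R))"
    using ereal_dense2[OF assms] by blast
  have "\<not> (\<forall>\<^sub>F R in at_top. \<not> c < f (4 * R))"
  proof
    assume *: "\<forall>\<^sub>F R in at_top. \<not> c < f (4 * R)"
    have "filterlim (\<lambda>R::real. 1 / 4 * R) at_top at_top"
      by (rule filterlim_tendsto_pos_mult_at_top[OF tendsto_const _ filterlim_ident]) simp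
    then have "\<forall>\<^sub>F R in at_top. \<not> c < f (4 * (1 / 4 * R))"
      using * by (rule eventually_compose_filterlim[rotated])
    then have "\<forall>\<^sub>F R in at_top. ereal (f R) \<le> ereal c"
      by eventually_elim simp
    then have "Limsup at_top (\<lambda>R. ereal (f R)) \<le> ereal c"
      by (rule Limsup_bounded)
    then show False using c by simp
  qed
  then show ?thesis using c by (auto simp: frequently_def)
qed

lemma eventually_le_if_INF_eq:
  fixes K :: "real \<Rightarrow> real"
  assumes "\<And>r. r > 0 \<Longrightarrow> K r > 0" "\<And>R. R > R0 \<Longrightarrow> (INF r\<in>{0<..<R}. K r) = K R"
  shows "\<forall>\<^sub>F R in at_top. \<forall>r. 0 < r \<longrightarrow> r < R \<longrightarrow> K R \<le> K r"
  using eventually_gt_at_top[of R0]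
proof eventually_elim
  case (elim R)
  \<comment> \<open>A real infimum is a lower bound only if the set is bounded below, which
    positivity of \<open>K\<close> ensures.\<close>
  have "bdd_below (K ` {0<..<R})"
    using assms(1) by (intro bdd_belowI2[of _ 0]) (auto intro: less_imp_le)
  then show ?case
    using assms(2)[OF elim] by (metis cINF_lower greaterThanLessThan_iff)
qed

section \<open>Energies of the core and of the outer region\<close>

context scaled_test
begin

lemma energy_Q_tendsto:
  assumes "w \<in> borel_measurable borel"
  shows "((\<lambda>R. energy c w (indicator (Q R))) \<longlongrightarrow> energy c w (\<lambda>z. 1)) at_top"
proof (rule energy_exhaustion[OF assms Q_measurable])
  define \<alpha> where "\<alpha> = 2 * real m / real k"
  have \<alpha>: "\<alpha> > 0" using m k by (simp add: \<alpha>_def)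
  have T: "T R = R powr \<alpha>" for R by (simp add: T_def \<alpha>_def)
  show "Q R \<subseteq> Q S" if "0 \<le> R" "R \<le> S" for R S
  proof -
    have "T R \<le> T S"
      unfolding T using that \<alpha> by (intro powr_mono2) auto
    then show ?thesis using that by (auto simp: Q_def)
  qed
  show "\<exists>R\<ge>0. z \<in> Q R" for z
  proof -
    define R where "R = max (norm (fst z) + 1) ((\<bar>snd z\<bar> + 1) powr (1 / \<alpha>))"
    have "\<bar>snd z\<bar> + 1 = ((\<bar>snd z\<bar> + 1) powr (1 / \<alpha>)) powr \<alpha>"
      using \<alpha> by (simp add: powr_powr)
    also have "\<dots> \<le> T R"
      unfolding T using \<alpha> by (intro powr_mono2) (auto simp: R_def)
    finally have "\<bar>snd z\<bar> < T R" by simp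
    moreover have "norm (fst z) < R" by (simp add: R_def less_max_iff_disj)
    ultimately show ?thesis
      by (intro exI[of _ R]) (auto simp: Q_def mem_Times_iff R_def le_max_iff_disj)
  qed
qed

lemma energy_Q_outer:
  assumes "w \<in> borel_measurable borel" "R > 0"
  shows "energy c w (indicator (Q R)) + energy c w (outer R) \<le> energy c w (\<phi>s R)"
proof -
  have "energy c w (indicator (Q R)) + energy c w (outer R)
      \<le> energy c w (\<lambda>z. indicator (Q R) z + outer R z)"
    by (rule energy_superadditive) (use assms(1) outer_nonneg in auto)
  then show ?thesis using core_plus_outer[OF assms(2)] by simp
qed

lemma energy_\<phi>s_le: "energy c w (\<phi>s R) \<le> energy c w (\<lambda>z. 1)"
  by (intro energy_mono \<phi>s_le_1)

lemma energy_outer_le: "energy c w (outer R) \<le> energy c w (\<phi>s R)"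
  by (intro energy_mono outer_le)

end

lemma weak_solution_vanishes:
  fixes m k :: nat and p q n s :: real and K L :: "real \<Rightarrow> real"
    and u0 v0 :: "nat \<Rightarrow> 'a::euclidean_space \<Rightarrow> real" and u v :: "'a \<times> real \<Rightarrow> real"
  assumes m: "m \<ge> 1" and k: "k \<ge> 1" and pq: "p + q > 2" and ns: "n + s > 2"
    and K: "\<And>r. r > 0 \<Longrightarrow> K r > 0" "\<forall>\<^sub>F R in at_top. \<forall>r. 0 < r \<longrightarrow> r < R \<longrightarrow> K R \<le> K r"
    and L: "\<And>r. r > 0 \<Longrightarrow> L r > 0" "\<forall>\<^sub>F R in at_top. \<forall>r. 0 < r \<longrightarrow> r < R \<longrightarrow> L R \<le> L r"
    and limsup: "Limsup at_top (\<lambda>R::real. ereal (K R * L R powr (1 / (n + s)) *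
           R powr ((2 * DIM('a) + 2 * m / k) / ((n + s) * (p + q))
                   + (DIM('a) + 2 * m) / (n + s) - DIM('a) + 2 * m * (1 - 1 / k)))) > 0"
    and sol: "weak_solution k m K L p q n s u0 v0 u v"
    and u0: "(AE x in lebesgue. 0 \<le> u0 (k - 1) x) \<or>
      integrable lebesgue (u0 (k - 1)) \<and> (LINT x|lebesgue. u0 (k - 1) x) > 0"
    and v0: "(AE x in lebesgue. 0 \<le> v0 (k - 1) x) \<or>
      integrable lebesgue (v0 (k - 1)) \<and> (LINT x|lebesgue. v0 (k - 1) x) > 0"
  shows "AE z in lebesgue. z \<in> upper_half \<longrightarrow> u z = 0 \<and> v z = 0"
proof -
  have u_meas: "set_borel_measurable lebesgue upper_half u"
    and v_meas: "set_borel_measurable lebesgue upper_half v"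
    and fin: "conv_finite K p v" "conv_finite L n u"
    and weak: "weak_inequality k m u0 u (\<lambda>z. conv K p v z * \<bar>v z\<bar> powr q)"
      "weak_inequality k m v0 v (\<lambda>z. conv L n u z * \<bar>u z\<bar> powr s)"
    using sol by (auto simp: weak_solution_def Lloc_def)
  obtain u' where u': "u' \<in> borel_measurable borel" "\<And>z. z \<notin> upper_half \<Longrightarrow> u' z = 0"
      "AE z in lborel. z \<in> upper_half \<longrightarrow> u z = u' z"
    using borel_representative[OF u_meas] by blast
  obtain v' where v': "v' \<in> borel_measurable borel" "\<And>z. z \<notin> upper_half \<Longrightarrow> v' z = 0"
      "AE z in lborel. z \<in> upper_half \<longrightarrow> v z = v' z"
    using borel_representative[OF v_meas] by blast
  \<comment> \<open>The exponents a = (p + q)/2 and (n + s)/2 both have to satisfy 1/a \<le>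
    \<theta> < 1.\<close>
  define \<theta> where "\<theta> = max (2 / (p + q)) (2 / (n + s))"
  have \<theta>: "0 < \<theta>" "\<theta> < 1" "2 / (p + q) \<le> \<theta>" "2 / (n + s) \<le> \<theta>"
    using pq ns by (auto simp: \<theta>_def less_max_iff_disj)
  obtain \<phi> :: "'a \<times> real \<Rightarrow> real" and C where "scaled_test m k \<theta> C \<phi>"
    using test_function[OF m k \<theta>(1,2)] m k unfolding scaled_test_def by metis
  then interpret scaled_test m k \<theta> C \<phi> .
  define Ev where "Ev = energy ((p + q) / 2) v'"
  define Eu where "Eu = energy ((n + s) / 2) u'"
  define A1 where "A1 = - (2 * m) + DIM('a) * (1 - 2 / (n + s)) + 2 * m / k * (1 - 1 / (n + s))"
  define A2 where "A2 = - (2 * m) + DIM('a) * (1 - 2 / (p + q)) + 2 * m / k * (1 - 1 / (p + q))"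
  obtain B1 where B1: "B1 > 0" "\<forall>\<^sub>F R in at_top. Ev (\<phi>s R) < \<infinity> \<and> (Eu (outer R) < \<infinity> \<longrightarrow>
      K (4 * R) * enn2real (Ev (\<phi>s R)) \<le> B1 * R powr A1 * enn2real (Eu (outer R)) powr (1 / (n + s)))"
    using weak_energy_inequality[OF K fin(1) weak(1) u0 ns \<theta>(4) u'(1,3) v']
    unfolding Ev_def Eu_def A1_def by blast
  obtain B2 where B2: "B2 > 0" "\<forall>\<^sub>F R in at_top. Eu (\<phi>s R) < \<infinity> \<and> (Ev (outer R) < \<infinity> \<longrightarrow>
      L (4 * R) * enn2real (Eu (\<phi>s R)) \<le> B2 * R powr A2 * enn2real (Ev (outer R)) powr (1 / (p + q)))"
    using weak_energy_inequality[OF L fin(2) weak(2) v0 pq \<theta>(3) v'(1,3) u']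
    unfolding Ev_def Eu_def A2_def by blast
  \<comment> \<open>Each unknown has finite energy by its own lower estimate, so its outer energy is
    finite too; this discharges the premise in the other unknown's inequality.\<close>
  have bounds: "\<forall>\<^sub>F R in at_top. R > 0 \<and> Ev (\<phi>s R) < \<infinity> \<and> Eu (\<phi>s R) < \<infinity> \<and>
      Ev (outer R) < \<infinity> \<and> Eu (outer R) < \<infinity> \<and>
      K (4 * R) * enn2real (Ev (\<phi>s R)) \<le> B1 * R powr A1 * enn2real (Eu (outer R)) powr (1 / (n + s)) \<and>
      L (4 * R) * enn2real (Eu (\<phi>s R)) \<le> B2 * R powr A2 * enn2real (Ev (outer R)) powr (1 / (p + q))"
    using B1(2) B2(2) eventually_gt_at_top[of 0]
  proof eventually_elim
    case (elim R)
    have "Ev (outer R) < \<infinity>" "Eu (outer R) < \<infinity>"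
      using elim energy_outer_le order_le_less_trans unfolding Ev_def Eu_def by blast+
    then show ?case using elim by blast
  qed
  define X where "X = (2 * DIM('a) + 2 * m / k) / ((n + s) * (p + q))
                   + (DIM('a) + 2 * m) / (n + s) - DIM('a) + 2 * m * (1 - 1 / k)"
  have X: "X = - (A1 + A2 / (n + s))"
    unfolding X_def A1_def A2_def using critical_exponent[of "DIM('a)" m k "n + s" "p + q"] by simp
  obtain c where c: "c > 0"
    "\<exists>\<^sub>F R in at_top. c < K (4 * R) * L (4 * R) powr (1 / (n + s)) * (4 * R) powr X"
    using frequently_gt_of_Limsup_pos[OF limsup] unfolding X_def by blast
  have freq: "\<exists>\<^sub>F R in at_top. enn2real (Ev (\<phi>s R)) \<le>
      (B1 * B2 powr (1 / (n + s)) * 4 powr X / c) * enn2real (Ev (outer R)) powr (1 / ((p + q) * (n + s)))"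
  proof (rule frequently_rev_mp[OF c(2)], rule eventually_mono[OF bounds], intro impI)
    fix R
    assume R: "R > 0 \<and> Ev (\<phi>s R) < \<infinity> \<and> Eu (\<phi>s R) < \<infinity> \<and>
      Ev (outer R) < \<infinity> \<and> Eu (outer R) < \<infinity> \<and>
      K (4 * R) * enn2real (Ev (\<phi>s R)) \<le> B1 * R powr A1 * enn2real (Eu (outer R)) powr (1 / (n + s)) \<and>
      L (4 * R) * enn2real (Eu (\<phi>s R)) \<le> B2 * R powr A2 * enn2real (Ev (outer R)) powr (1 / (p + q))"
      and cR: "c < K (4 * R) * L (4 * R) powr (1 / (n + s)) * (4 * R) powr X"
    show "enn2real (Ev (\<phi>s R)) \<le>
      (B1 * B2 powr (1 / (n + s)) * 4 powr X / c) * enn2real (Ev (outer R)) powr (1 / ((p + q) * (n + s)))"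
    proof (rule combine_energy_bounds[OF _ _ B1(1) B2(1) _ c(1) _ _ _ _ _ _ _ cR X])
      show "enn2real (Eu (outer R)) \<le> enn2real (Eu (\<phi>s R))"
        using R energy_outer_le unfolding Eu_def by (intro enn2real_mono) auto
    qed (use R K(1) L(1) ns in auto)
  qed
  have "Ev (\<lambda>z. 1) = 0"
  proof (rule energy_limit_eq_0[OF _ _ freq])
    show "((\<lambda>R. Ev (indicator (Q R))) \<longlongrightarrow> Ev (\<lambda>z. 1)) at_top"
      unfolding Ev_def by (rule energy_Q_tendsto[OF v'(1)])
    show "\<forall>\<^sub>F R in at_top. Ev (\<phi>s R) < \<infinity> \<and> Ev (indicator (Q R)) + Ev (outer R) \<le> Ev (\<phi>s R)
        \<and> Ev (\<phi>s R) \<le> Ev (\<lambda>z. 1)"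
      using bounds by eventually_elim
        (use energy_Q_outer[OF v'(1)] energy_\<phi>s_le in \<open>auto simp: Ev_def\<close>)
    \<comment> \<open>The product exceeds 4, so its reciprocal is the exponent below 1 that
      absorption requires.\<close>
    have "2 * 2 < (p + q) * (n + s)"
      using pq ns by (intro mult_strict_mono) auto
    then show "0 < 1 / ((p + q) * (n + s))" "1 / ((p + q) * (n + s)) < 1"
      by auto
  qed (use B1 B2 c in simp)
  then have Ev_0: "Ev (outer R) = 0" for R
    using energy_outer_le[of "(p + q) / 2" v' R] energy_\<phi>s_le[of "(p + q) / 2" v' R]
    unfolding Ev_def by (metis le_zero_eq order_trans)
  \<comment> \<open>With vanishing outer energy of v, the second inequality forces the energy of u
    against \<open>\<phi>s R\<close> to be 0 for every large R, because 0 to a positive power is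
    0.\<close>
  have "\<forall>\<^sub>F R in at_top. Eu (indicator (Q R)) = 0"
    using bounds
  proof eventually_elim
    case (elim R)
    then have "L (4 * R) * enn2real (Eu (\<phi>s R)) \<le> 0" by (simp add: Ev_0)
    moreover have "L (4 * R) > 0" using L(1) elim by simp
    ultimately have "enn2real (Eu (\<phi>s R)) = 0"
      by (metis enn2real_nonneg linorder_not_le mult_pos_pos order_antisym)
    then have "Eu (\<phi>s R) = 0" using elim by (auto simp: enn2real_eq_0_iff)
    moreover have "Eu (indicator (Q R)) \<le> Eu (\<phi>s R)"
      using energy_Q_outer[OF u'(1), of R] elim unfolding Eu_def
      by (meson add_increasing2 order_refl order_trans zero_le)
    ultimately show ?case by simp
  qed
  then have "((\<lambda>R. Eu (indicator (Q R))) \<longlongrightarrow> 0) at_top"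
    by (rule tendsto_eventually)
  moreover have "((\<lambda>R. Eu (indicator (Q R))) \<longlongrightarrow> Eu (\<lambda>z. 1)) at_top"
    unfolding Eu_def by (rule energy_Q_tendsto[OF u'(1)])
  ultimately have "Eu (\<lambda>z. 1) = 0"
    using tendsto_unique[OF trivial_limit_at_top_linorder] by blast
  then have "AE z in lborel. u' z = 0"
    using AE_eq_0_if_energy_eq_0[OF u'(1), of "(n + s) / 2"] ns by (simp add: Eu_def)
  moreover have "AE z in lborel. v' z = 0"
    using AE_eq_0_if_energy_eq_0[OF v'(1), of "(p + q) / 2"] pq \<open>Ev (\<lambda>z. 1) = 0\<close> by (simp add: Ev_def)
  ultimately have "AE z in lborel. z \<in> upper_half \<longrightarrow> u z = 0 \<and> v z = 0"
    using u'(3) v'(3) by eventually_elim auto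
  then show ?thesis by (simp add: AE_completion_iff)
qed

theorem theorem1p4:
  fixes m k :: nat and p q n s :: real
    and K L :: "real \<Rightarrow> real"
    and u0 v0 :: "nat \<Rightarrow> 'a::euclidean_space \<Rightarrow> real"
    and u v :: "'a \<times> real \<Rightarrow> real"
  assumes "m \<ge> 1" and "k \<ge> 1"
    and "p > 0" and "q > 0" and "n > 0" and "s > 0"
    and "min (p + q) (n + s) > 2"
    and "continuous_on {0<..} K" and "continuous_on {0<..} L"
    and "\<And>r. r > 0 \<Longrightarrow> K r > 0" and "\<And>r. r > 0 \<Longrightarrow> L r > 0"
    and "(\<lambda>x::'a. K (norm x)) \<in> Lloc 1 UNIV" and "(\<lambda>x::'a. L (norm x)) \<in> Lloc 1 UNIV"
    and "\<exists>R0>1. \<forall>R>R0. (INF r\<in>{0<..<R}. K r) = K R \<and> (INF r\<in>{0<..<R}. L r) = L R"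
    and "Limsup at_top (\<lambda>R::real. ereal (K R * L R powr (1 / (n + s)) *
           R powr ((2 * DIM('a) + 2 * m / k) / ((n + s) * (p + q))
                   + (DIM('a) + 2 * m) / (n + s) - DIM('a) + 2 * m * (1 - 1 / k)))) > 0
       \<or> Limsup at_top (\<lambda>R::real. ereal (K R powr (1 / (p + q)) * L R *
           R powr ((2 * DIM('a) + 2 * m / k) / ((n + s) * (p + q))
                   + (DIM('a) + 2 * m) / (p + q) - DIM('a) + 2 * m * (1 - 1 / k)))) > 0"
    and "weak_solution k m K L p q n s u0 v0 u v"
    and "(AE x in lebesgue. 0 \<le> u0 (k - 1) x) \<and> (AE x in lebesgue. 0 \<le> v0 (k - 1) x)
       \<or> integrable lebesgue (u0 (k - 1)) \<and> integrable lebesgue (v0 (k - 1)) \<and>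
         (LINT x|lebesgue. u0 (k - 1) x) > 0 \<and> (LINT x|lebesgue. v0 (k - 1) x) > 0"
  shows "AE z in lebesgue. z \<in> upper_half \<longrightarrow> u z = 0 \<and> v z = 0"
proof -
  obtain R0 where R0: "\<And>R. R > R0 \<Longrightarrow> (INF r\<in>{0<..<R}. K r) = K R"
      "\<And>R. R > R0 \<Longrightarrow> (INF r\<in>{0<..<R}. L r) = L R"
    using assms(14) by blast
  have K: "\<forall>\<^sub>F R in at_top. \<forall>r. 0 < r \<longrightarrow> r < R \<longrightarrow> K R \<le> K r"
    using assms(10) R0(1) by (rule eventually_le_if_INF_eq)
  have L: "\<forall>\<^sub>F R in at_top. \<forall>r. 0 < r \<longrightarrow> r < R \<longrightarrow> L R \<le> L r"
    using assms(11) R0(2) by (rule eventually_le_if_INF_eq)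
  have u0: "(AE x in lebesgue. 0 \<le> u0 (k - 1) x) \<or>
      integrable lebesgue (u0 (k - 1)) \<and> (LINT x|lebesgue. u0 (k - 1) x) > 0"
    and v0: "(AE x in lebesgue. 0 \<le> v0 (k - 1) x) \<or>
      integrable lebesgue (v0 (k - 1)) \<and> (LINT x|lebesgue. v0 (k - 1) x) > 0"
    using assms(17) by auto
  have pq: "p + q > 2" and ns: "n + s > 2" using assms(7) by auto
  \<comment> \<open>The system is invariant under exchanging (u, K, p, q) with (v, L, n, s), and the
    second upper limit condition is the first one for the exchanged system.\<close>
  have swapped: "weak_solution k m L K n s p q v0 u0 v u"
    using assms(16) by (auto simp: weak_solution_def)
  from assms(15) show ?thesis
  proof
    assume *: "Limsup at_top (\<lambda>R::real. ereal (K R * L R powr (1 / (n + s)) *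
           R powr ((2 * DIM('a) + 2 * m / k) / ((n + s) * (p + q))
                   + (DIM('a) + 2 * m) / (n + s) - DIM('a) + 2 * m * (1 - 1 / k)))) > 0"
    show ?thesis
      by (rule weak_solution_vanishes[OF assms(1,2) pq ns assms(10) K assms(11) L * assms(16) u0 v0])
  next
    assume "Limsup at_top (\<lambda>R::real. ereal (K R powr (1 / (p + q)) * L R *
           R powr ((2 * DIM('a) + 2 * m / k) / ((n + s) * (p + q))
                   + (DIM('a) + 2 * m) / (p + q) - DIM('a) + 2 * m * (1 - 1 / k)))) > 0"
    then have *: "Limsup at_top (\<lambda>R::real. ereal (L R * K R powr (1 / (p + q)) *
           R powr ((2 * DIM('a) + 2 * m / k) / ((p + q) * (n + s))
                   + (DIM('a) + 2 * m) / (p + q) - DIM('a) + 2 * m * (1 - 1 / k)))) > 0"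
      by (simp only: mult.commute[of "L _"] mult.commute[of "p + q" "n + s"])
    have "AE z in lebesgue. z \<in> upper_half \<longrightarrow> v z = 0 \<and> u z = 0"
      by (rule weak_solution_vanishes[OF assms(1,2) ns pq assms(11) L assms(10) K * swapped v0 u0])
    then show ?thesis by eventually_elim blast
  qed
qed

end
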